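(* For all $m\in\mathbb N$, $m\ge2$, and for every $\delta\in(0,1)$, the $\tanh$ NN $\Psi^{\mathrm{Cheb},m}_\delta$ defined recursively in the context satisfies $$\|T_k-\mathrm R(\Psi^{\mathrm{Cheb},m}_\delta)_k\|_{W^{1,\infty}((-1,1))}\le\delta\qquad\text{for all }k=1,\dots,m,$$ where $\mathrm R(\cdot)_k$ denotes the $k$-th component of the realization, and, for some constant $C$ which is independent of $m$ and $\delta$, $$L(\Psi^{\mathrm{Cheb},m}_\delta)=\lceil\log_2(m)\rceil+1,\qquad M(\Psi^{\mathrm{Cheb},m}_\delta)\le Cm.$$
   Context: $T_k$ is the Chebyshev polynomial of the first kind of degree $k$, normalized by $T_k(1)=1$. For a domain $D\subset\mathbb R^d$, $\|F\|_{W^{1,\infty}(D)}=\max\{\|F\|_{L^\infty(D)},\max_{j=1}^d\|\partial_{x_j}F\|_{L^\infty(D)}\}$. **Neural networks (NNs).** For $d,L\in\mathbb N$, a NN with input dimension $d$ and $L$ layers is a finite sequence $\Phi=((A_1,b_1),\dots,(A_L,b_L))$ with $N_0=d$, $N_1,\dots,N_L\in\mathbb N$, $A_\ell\in\mathbb R^{N_\ell\times N_{\ell-1}}$, $b_\ell\in\mathbb R^{N_\ell}$; $N_L$ is its output dimension. For an activation $\varrho:\mathbb R\to\mathbb R$ (applied componentwise) its realization is $\mathrm R(\Phi):\mathbb R^d\to\mathbb R^{N_L}$, $x\mapsto x_L$, where $x_0=x$, $x_\ell=\varrho(A_\ell x_{\ell-1}+b_\ell)$ for $\ell=1,\dots,L-1$,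 and $x_L=A_Lx_{L-1}+b_L$. The depth is $L(\Phi)=L$ and the size is $M(\Phi)=\sum_{\ell=1}^L(\|A_\ell\|_0+\|b_\ell\|_0)$, where $\|\cdot\|_0$ counts nonzero entries. A $\tanh$ NN uses only the activation $\varrho=\tanh$. A depth-1 NN $((A,b))$ realizes the affine map $x\mapsto Ax+b$. **Operations.** The full parallelization $\mathrm{FP}(\Phi^1,\Phi^2)$ of two NNs of equal depth $L$, $\Phi^i=((A^{(i)}_\ell,b^{(i)}_\ell))_{\ell=1}^L$, is the NN with layers $A_\ell=\operatorname{diag}(A^{(1)}_\ell,A^{(2)}_\ell)$ (block diagonal), $b_\ell=(b^{(1)}_\ell,b^{(2)}_\ell)$ (stacked), so $\mathrm R(\mathrm{FP}(\Phi^1,\Phi^2))(x_1,x_2)=(\mathrm R(\Phi^1)(x_1),\mathrm R(\Phi^2)(x_2))$; for more than two NNs it is applied repeatedly. The concatenation $\Phi^1\bullet\Phi^2$ of NNs with depths $L^{(1)},L^{(2)}$, where the output dimension of $\Phi^2$ equals the input dimension of $\Phi^1$, is the NN of depth $L^{(1)}+L^{(2)}-1$ consisting of the first $L^{(2)}-1$ layers of $\Phi^2$, then the layer $(A^{(1)}_1A^{(2)}_{L^{(2)}},\,A^{(1)}_1b^{(2)}_{L^{(2)}}+b^{(1)}_1)$, then the layers $2,\dots,L^{(1)}$ of $\Phi^1$; thus $\mathrm R(\Phi^1\bullet\Phi^2)=\mathrm R(\Phi^1)\circ\mathrm R(\Phi^2)$. **Building blocks.** There is a constant $C_*>0$ such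 that for all $\tau,B>0$ there exist $\tanh$ NNs as follows, which we fix: (i) $\Phi^{\mathrm{Id}}_{1,\tau,B}$ of depth 2, with input and output dimension 1, with $\|\mathrm{Id}_{\mathbb R}-\mathrm R(\Phi^{\mathrm{Id}}_{1,\tau,B})\|_{W^{1,\infty}((-B,B))}\le\tau$, size at most $2C_*$ and hidden layer dimension at most $C_*$; (ii) $\Phi^{\mathrm{Prod}}_{\tau,B}$ of depth 2, with input dimension 2 and output dimension 1, with $\|x_1x_2-\mathrm R(\Phi^{\mathrm{Prod}}_{\tau,B})(x_1,x_2)\|_{W^{1,\infty}((-B,B)^2)}\le\tau$ and size at most $C_*$. For $d\in\mathbb N$, $\Phi^{\mathrm{Id}}_{d,\tau,B}:=\mathrm{FP}(\Phi^{\mathrm{Id}}_{1,\tau,B},\dots,\Phi^{\mathrm{Id}}_{1,\tau,B})$ ($d$ copies). **Definition of $\Psi^{\mathrm{Cheb},m}_\delta$.** For $m=2$ and $\delta\in(0,1)$, $$\Psi^{\mathrm{Cheb},2}_\delta:=((\operatorname{diag}(1,2),(0,-1)^\top))\bullet\mathrm{FP}\big(\Phi^{\mathrm{Id}}_{1,\delta,1},\Phi^{\mathrm{Prod}}_{\delta/4,1}\big)\bullet(((1,1,1)^\top,0)),$$ with realization $x\mapsto\big(\mathrm R(\Phi^{\mathrm{Id}}_{1,\delta,1})(x),\,2\mathrm R(\Phi^{\mathrm{Prod}}_{\delta/4,1})(x,x)-1\big)$. For $m>2$ and $\delta\in(0,1)$, let $\tilde m:=\min\{2^k:2^k\ge m,\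 k\in\mathbb N\}$ (so $\tilde m/2<m$ is an even power of two, $\tilde m/2\geq 2$) and $\theta:=\delta/(4m^2)$. Let $A^{m}_{1}\in\mathbb R^{(2m-\tilde m/2)\times(\tilde m/2)}$ have entries $(A^m_1)_{ij}=1$ if $i=j\le\tilde m/2$, or if $i>\tilde m/2$ and $j=\tilde m/4+\lceil(i-1-\tilde m/2)/4\rceil$, and $0$ else; let $b^m_1=0\in\mathbb R^{2m-\tilde m/2}$. Let $A^m_2\in\mathbb R^{m\times m}$ have entries $(A^m_2)_{ij}=1$ if $i=j\le\tilde m/2$; $2$ if $i=j>\tilde m/2$; $-1$ if $i>\tilde m/2$ is odd and $j=1$; $0$ else. Let $b^m_2\in\mathbb R^m$ have entries $(b^m_2)_i=-1$ if $i>\tilde m/2$ is even, and $0$ else. Then, recursively, $$\Psi^{\mathrm{Cheb},m}_\delta:=((A^m_2,b^m_2))\bullet\mathrm{FP}\big(\Phi^{\mathrm{Id}}_{\tilde m/2,\theta,2},\Phi^{\mathrm{Prod}}_{\theta,2},\dots,\Phi^{\mathrm{Prod}}_{\theta,2}\big)\bullet((A^m_1,b^m_1))\bullet\Psi^{\mathrm{Cheb},\tilde m/2}_\theta,$$ with $m-\tilde m/2$ product networks in the full parallelization. Equivalently, writing $\widetilde T_j=\mathrm R(\Psi^{\mathrm{Cheb},\tilde m/2}_\theta)_j$, the $j$-th component of $\mathrm R(\Psi^{\mathrm{Cheb},m}_\delta):\mathbb R\to\mathbb R^m$ is $\mathrm R(\Phi^{\mathrm{Id}}_{1,\theta,2})\circ\widetilde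 T_j$ if $j\le\tilde m/2$; $2\mathrm R(\Phi^{\mathrm{Prod}}_{\theta,2})(\widetilde T_{\lfloor j/2\rfloor},\widetilde T_{\lceil j/2\rceil})-1$ if $j>\tilde m/2$ is even; and $2\mathrm R(\Phi^{\mathrm{Prod}}_{\theta,2})(\widetilde T_{\lfloor j/2\rfloor},\widetilde T_{\lceil j/2\rceil})-\mathrm R(\Phi^{\mathrm{Id}}_{1,\theta,2})\circ\widetilde T_1$ if $j>\tilde m/2$ is odd. (This mirrors $T_{m+n}=2T_mT_n-T_{|m-n|}$.) *)

theory Defs
  imports
    "HOL-Probability.Essential_Supremum"
    "HOL-Computational_Algebra.Polynomial"
    "Jordan_Normal_Form.Matrix"
begin

unbundle no vec_syntax

subsection \<open>Chebyshev polynomials of the first kind\<close>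

fun cheb :: "nat \<Rightarrow> real poly" where
  "cheb 0 = 1"
| "cheb (Suc 0) = [:0, 1:]"
| "cheb (Suc (Suc n)) = [:0, 2:] * cheb (Suc n) - cheb n"

lemma poly_cheb_1: "poly (cheb n) 1 = 1"
  by (induction n rule: cheb.induct) simp_all

lemma poly_cheb_cos: "poly (cheb n) (cos t) = cos (real n * t)"
proof (induction n rule: cheb.induct)
  case (3 n)
  have "cos (real (Suc (Suc n)) * t) = cos (real (Suc n) * t + t)"
       "cos (real n * t) = cos (real (Suc n) * t - t)"
    by (simp_all add: algebra_simps)
  then have "cos (real (Suc (Suc n)) * t) + cos (real n * t) = 2 * cos t * cos (real (Suc n) * t)"
    unfolding cos_add cos_diff by (simp only:) (simp add: algebra_simps)
  then show ?case using 3 by (simp add: algebra_simps)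
qed simp_all

subsection \<open>The norm of the Sobolev space of order one with exponent infinity\<close>

definition linf_norm :: "'a::euclidean_space set \<Rightarrow> ('a \<Rightarrow> real) \<Rightarrow> ereal" where
  "linf_norm D F = esssup (lebesgue_on D) (\<lambda>x. ereal \<bar>F x\<bar>)"

definition partial_deriv :: "'a::euclidean_space \<Rightarrow> ('a \<Rightarrow> real) \<Rightarrow> 'a \<Rightarrow> real" where
  "partial_deriv e F x = deriv (\<lambda>t. F (x + t *\<^sub>R e)) 0"

text \<open>Classical partial derivatives are used.  They agree with the weak ones on the functions
  considered here, which are continuously differentiable on all of the Euclidean space
  (differences of polynomials and realizations of networks with activation \<^const>\<open>tanh\<close>).\<close>

definition w1inf_norm :: "'a::euclidean_space set \<Rightarrow> ('a \<Rightarrow> real) \<Rightarrow> ereal" where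
  "w1inf_norm D F = max (linf_norm D F) (MAX e\<in>Basis. linf_norm D (partial_deriv e F))"

subsection \<open>Neural networks\<close>

type_synonym nn = "(real mat \<times> real vec) list"

text \<open>\<open>is_nn d n \<Phi>\<close>: \<open>\<Phi>\<close> is a network with input dimension \<open>d\<close> and output dimension \<open>n\<close>.
  All layer dimensions are positive.\<close>

fun is_nn :: "nat \<Rightarrow> nat \<Rightarrow> nn \<Rightarrow> bool" where
  "is_nn d n [] \<longleftrightarrow> False"
| "is_nn d n [(A, b)] \<longleftrightarrow> 0 < d \<and> 0 < n \<and> A \<in> carrier_mat n d \<and> b \<in> carrier_vec n"
| "is_nn d n ((A, b) # \<Phi>) \<longleftrightarrow>
     0 < d \<and> A \<in> carrier_mat (dim_vec b) d \<and> is_nn (dim_vec b) n \<Phi>"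

fun realization :: "(real \<Rightarrow> real) \<Rightarrow> nn \<Rightarrow> real vec \<Rightarrow> real vec" where
  "realization \<rho> [] x = x"
| "realization \<rho> [(A, b)] x = A *\<^sub>v x + b"
| "realization \<rho> ((A, b) # \<Phi>) x = realization \<rho> \<Phi> (map_vec \<rho> (A *\<^sub>v x + b))"

definition depth :: "nn \<Rightarrow> nat" where
  "depth \<Phi> = length \<Phi>"

definition nnz_mat :: "real mat \<Rightarrow> nat" where
  "nnz_mat A = card {(i, j). i < dim_row A \<and> j < dim_col A \<and> A $$ (i, j) \<noteq> 0}"

definition nnz_vec :: "real vec \<Rightarrow> nat" where
  "nnz_vec b = card {i. i < dim_vec b \<and> b $ i \<noteq> 0}"

definition nn_size :: "nn \<Rightarrow> nat" where
  "nn_size \<Phi> = (\<Sum>(A, b)\<leftarrow>\<Phi>. nnz_mat A + nnz_vec b)"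

fun par_layer :: "real mat \<times> real vec \<Rightarrow> real mat \<times> real vec \<Rightarrow> real mat \<times> real vec" where
  "par_layer (A, b) (A', b') =
     (four_block_mat A (0\<^sub>m (dim_row A) (dim_col A')) (0\<^sub>m (dim_row A') (dim_col A)) A',
      b @\<^sub>v b')"

definition FP2 :: "nn \<Rightarrow> nn \<Rightarrow> nn" where
  "FP2 \<Phi> \<Psi> = map2 par_layer \<Phi> \<Psi>"

fun FP :: "nn list \<Rightarrow> nn" where
  "FP [] = []"
| "FP [\<Phi>] = \<Phi>"
| "FP (\<Phi> # \<Psi> # \<Psi>s) = FP2 \<Phi> (FP (\<Psi> # \<Psi>s))"

definition nn_concat :: "nn \<Rightarrow> nn \<Rightarrow> nn" (infixr \<open>\<bullet>\<^sub>N\<close> 70) where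
  "\<Phi> \<bullet>\<^sub>N \<Psi> =
     (let (A, b) = hd \<Phi>; (A', b') = last \<Psi>
      in butlast \<Psi> @ (A * A', A *\<^sub>v b' + b) # tl \<Phi>)"

subsection \<open>Building blocks\<close>

definition id_block :: "real \<Rightarrow> real \<Rightarrow> real \<Rightarrow> nn \<Rightarrow> bool" where
  "id_block C \<tau> B \<Phi> \<longleftrightarrow>
     is_nn 1 1 \<Phi> \<and> depth \<Phi> = 2 \<and>
     w1inf_norm {-B<..<B} (\<lambda>x. x - realization tanh \<Phi> (vec_of_list [x]) $ 0) \<le> ereal \<tau> \<and>
     real (nn_size \<Phi>) \<le> 2 * C \<and>
     real (dim_vec (snd (\<Phi> ! 0))) \<le> C"

definition prod_block :: "real \<Rightarrow> real \<Rightarrow> real \<Rightarrow> nn \<Rightarrow> bool" where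
  "prod_block C \<tau> B \<Phi> \<longleftrightarrow>
     is_nn 2 1 \<Phi> \<and> depth \<Phi> = 2 \<and>
     w1inf_norm ({-B<..<B} \<times> {-B<..<B})
       (\<lambda>(x, y). x * y - realization tanh \<Phi> (vec_of_list [x, y]) $ 0) \<le> ereal \<tau> \<and>
     real (nn_size \<Phi>) \<le> C"

text \<open>\<open>Id1 \<tau> B\<close> below is the chosen scalar identity network.\<close>

definition id_nn :: "(real \<Rightarrow> real \<Rightarrow> nn) \<Rightarrow> nat \<Rightarrow> real \<Rightarrow> real \<Rightarrow> nn" where
  "id_nn Id1 d \<tau> B = FP (replicate d (Id1 \<tau> B))"

subsection \<open>The Chebyshev networks\<close>

definition mtilde :: "nat \<Rightarrow> nat" where
  "mtilde m = (LEAST n. m \<le> n \<and> (\<exists>k. n = 2 ^ k))"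

lemma mtilde_half_less:
  assumes "2 < m"
  shows "mtilde m div 2 < m"
proof (rule ccontr)
  assume *: "\<not> mtilde m div 2 < m"
  have "\<exists>n. m \<le> n \<and> (\<exists>k. n = 2 ^ k)"
    by (metis less_exp less_imp_le)
  then have "m \<le> mtilde m \<and> (\<exists>k. mtilde m = 2 ^ k)"
    unfolding mtilde_def by (rule LeastI_ex)
  then obtain k where k: "m \<le> mtilde m" "mtilde m = 2 ^ k" by blast
  with assms have "k \<noteq> 0" by (intro notI) simp
  then obtain l where "k = Suc l" by (cases k) auto
  with k * have "m \<le> 2 ^ l" by simp
  then have "mtilde m \<le> 2 ^ l"
    unfolding mtilde_def by (intro Least_le) blast
  with k \<open>k = Suc l\<close> show False by simp
qed

text \<open>The matrix entries are described with indices \<open>i\<close> and \<open>j\<close> that start at 1, whereas those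
  of \<^const>\<open>mat\<close> and \<^const>\<open>vec\<close> start at 0.\<close>

definition cheb_A1 :: "nat \<Rightarrow> real mat" where
  "cheb_A1 m =
     (let h = mtilde m div 2 in
      mat (2 * m - h) h (\<lambda>(i0, j0). let i = i0 + 1; j = j0 + 1 in
        if (i = j \<and> i \<le> h) \<or>
           (i > h \<and> real j = real (mtilde m) / 4 + of_int \<lceil>(real i - 1 - real h) / 4\<rceil>)
        then 1 else 0))"

definition cheb_b1 :: "nat \<Rightarrow> real vec" where
  "cheb_b1 m = 0\<^sub>v (2 * m - mtilde m div 2)"

definition cheb_A2 :: "nat \<Rightarrow> real mat" where
  "cheb_A2 m =
     (let h = mtilde m div 2 in
      mat m m (\<lambda>(i0, j0). let i = i0 + 1; j = j0 + 1 in
        if i = j \<and> i \<le> h then 1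
        else if i = j \<and> i > h then 2
        else if i > h \<and> odd i \<and> j = 1 then -1
        else 0))"

definition cheb_b2 :: "nat \<Rightarrow> real vec" where
  "cheb_b2 m =
     (let h = mtilde m div 2 in
      vec m (\<lambda>i0. let i = i0 + 1 in if i > h \<and> even i then -1 else 0))"

text \<open>The value for \<open>m < 2\<close> is a dummy.\<close>

function cheb_nn ::
  "(real \<Rightarrow> real \<Rightarrow> nn) \<Rightarrow> (real \<Rightarrow> real \<Rightarrow> nn) \<Rightarrow> nat \<Rightarrow> real \<Rightarrow> nn" where
  "cheb_nn Id1 Prd m \<delta> =
     (if m < 2 then []
      else if m = 2 then
        [(mat_of_rows_list 2 [[1, 0], [0, 2]], vec_of_list [0, -1])]
        \<bullet>\<^sub>N FP2 (Id1 \<delta> 1) (Prd (\<delta> / 4) 1)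
        \<bullet>\<^sub>N [(mat_of_rows_list 1 [[1], [1], [1]], 0\<^sub>v 3)]
      else
        (let h = mtilde m div 2; \<theta> = \<delta> / (4 * (real m)\<^sup>2) in
         [(cheb_A2 m, cheb_b2 m)]
         \<bullet>\<^sub>N FP (id_nn Id1 h \<theta> 2 # replicate (m - h) (Prd \<theta> 2))
         \<bullet>\<^sub>N [(cheb_A1 m, cheb_b1 m)]
         \<bullet>\<^sub>N cheb_nn Id1 Prd h \<theta>))"
  by pat_completeness auto
termination
  by (relation "Wellfounded.measure (\<lambda>(Id1, Prd, m, \<delta>). m)") (auto simp: mtilde_half_less)

declare cheb_nn.simps [simp del]

end

theory Submission
  imports Defs
begin

text \<open>
  The recursion mirrors \<open>T\<^sub>j = 2 T\<^sub>a T\<^sub>b - T\<^bsub>b - a\<^esub>\<close> with \<open>a + b = j\<close> and \<open>b - a \<le> 1\<close>.  On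
  \<open>(-1, 1)\<close> we have \<open>\<bar>T\<^sub>k\<bar> \<le> 1\<close> and \<open>\<bar>T\<^sub>k'\<bar> \<le> k\<^sup>2\<close>, so approximations of the previous level
  with error \<open>\<theta> < 1\<close> take values in \<open>(-2, 2)\<close>, where the building blocks are accurate, and one
  step multiplies the error by at most \<open>4 (a\<^sup>2 + b\<^sup>2) + 15 \<le> 2 j\<^sup>2 + 17 \<le> 4 m\<^sup>2\<close>, the last step
  because \<open>m \<ge> 3\<close>.

  For the size, every row of the last weight matrix of a Chebyshev network has boundedly many nonzero
  entries, so the layer that arises from merging it with the first layer of the next parallelization
  has \<open>O(m)\<close> nonzero weights.  The level dimensions are powers of two, so the sizes form a geometric sum.
\<close>

subsection \<open>Dimensions and realizations\<close>

text \<open>The hypotheses on the building blocks bound essential suprema, whereas the recursion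
  evaluates the blocks along curves x -> (f x, g x), for degree 2 along the diagonal of the square.
  Such a curve is a null set of the plane, so an almost-everywhere bound says nothing about it. The
  way out is that depth-2 \<open>tanh\<close> networks are explicit C^1 functions, and that on an
  open set a norm bound for a continuous function holds at every point. The recursion therefore
  carries pointwise bounds together with a derivative that is continuous on the whole real line, and
  the norm returns only in the final statement.

  The order m^2 in the tolerance comes from the derivatives: errors of values grow by a constant
  factor per level, errors of derivatives also pick up the size of T_k', which is of order k^2.

  The row bound for the size does not deteriorate from level to level: the last matrix of a new
  network is \<open>cheb_A2\<close> times the output matrix of the blocks and contains no weight of
  the previous network.\<close>

lemma is_nn_Cons:
  "\<Phi> \<noteq> [] \<Longrightarrow> is_nn d n ((A, b) # \<Phi>) \<longleftrightarrow>
     0 < d \<and> A \<in> carrier_mat (dim_vec b) d \<and> is_nn (dim_vec b) n \<Phi>"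
  by (cases \<Phi>) auto

lemma realization_Cons:
  "\<Phi> \<noteq> [] \<Longrightarrow> realization \<rho> ((A, b) # \<Phi>) x = realization \<rho> \<Phi> (map_vec \<rho> (A *\<^sub>v x + b))"
  by (cases \<Phi>) auto

lemma is_nn_nonempty: "is_nn d n \<Phi> \<Longrightarrow> \<Phi> \<noteq> []"
  by auto

text \<open>Both kinds of building blocks have depth 2; splitting them into two affine layers
  exposes the hidden width as \<open>dim_vec b\<close>.\<close>

lemma is_nn_length_2D:
  assumes "is_nn d n \<Phi>" and "length \<Phi> = 2"
  obtains A b A' b' where "\<Phi> = [(A, b), (A', b')]"
    and "A \<in> carrier_mat (dim_vec b) d" and "A' \<in> carrier_mat n (dim_vec b)" and "b' \<in> carrier_vec n"
proof -
  from assms(2) obtain x y where "\<Phi> = [x, y]"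
    by (auto simp: numeral_2_eq_2 length_Suc_conv)
  with assms(1) that show thesis by (cases x; cases y) auto
qed

lemma realization_dim:
  "is_nn d n \<Phi> \<Longrightarrow> x \<in> carrier_vec d \<Longrightarrow> realization \<rho> \<Phi> x \<in> carrier_vec n"
proof (induction d n \<Phi> arbitrary: x rule: is_nn.induct)
  case (3 d n A b v va)
  have "map_vec \<rho> (A *\<^sub>v x + b) \<in> carrier_vec (dim_vec b)" by (intro carrier_vecI) simp
  with "3.IH" "3.prems" show ?case unfolding realization.simps is_nn.simps by blast
qed auto

lemma nn_concat_single:
  "((A, b) # \<Phi>) \<bullet>\<^sub>N [(A', b')] = (A * A', A *\<^sub>v b' + b) # \<Phi>"
  by (simp add: nn_concat_def)

lemma nn_concat_Cons:
  "\<Psi> \<noteq> [] \<Longrightarrow> \<Phi> \<bullet>\<^sub>N (L # \<Psi>) = L # (\<Phi> \<bullet>\<^sub>N \<Psi>)"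
  by (simp add: nn_concat_def split: prod.split)

lemma nn_concat_nonempty: "\<Phi> \<bullet>\<^sub>N \<Psi> \<noteq> []"
  by (simp add: nn_concat_def split: prod.split)

text \<open>Two layers merge into one; the \<open>+ 1\<close> stands on the left to avoid
  subtraction of natural numbers.\<close>

lemma length_nn_concat:
  "\<Phi> \<noteq> [] \<Longrightarrow> \<Psi> \<noteq> [] \<Longrightarrow> length (\<Phi> \<bullet>\<^sub>N \<Psi>) + 1 = length \<Phi> + length \<Psi>"
  by (cases \<Phi>) (auto simp: nn_concat_def length_Suc_conv neq_Nil_conv split: prod.split)

text \<open>Only the last layer of the inner network \<Psi> is altered. Induction over \<Psi> copies
  its earlier layers and merges in the one-layer case.\<close>

lemma is_nn_concat:
  "is_nn d n \<Psi> \<Longrightarrow> is_nn n p \<Phi> \<Longrightarrow> is_nn d p (\<Phi> \<bullet>\<^sub>N \<Psi>)"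
proof (induction d n \<Psi> rule: is_nn.induct)
  case (2 d n A' b')
  then obtain A b \<Phi>' where \<Phi>: "\<Phi> = (A, b) # \<Phi>'" by (cases \<Phi>) auto
  show ?case using 2 unfolding \<Phi> by (cases "\<Phi>' = []") (auto simp: nn_concat_single is_nn_Cons)
next
  case (3 d n A b v va)
  then show ?case by (auto simp: nn_concat_Cons is_nn_Cons nn_concat_nonempty)
qed auto

text \<open>No activation acts between the last layer of \<Psi> and the first layer of \<Phi>, so
  their affine maps compose: A (A' x + b') + b = (A A') x + (A b' + b).\<close>

lemma realization_concat:
  "is_nn d n \<Psi> \<Longrightarrow> is_nn n p \<Phi> \<Longrightarrow> x \<in> carrier_vec d \<Longrightarrow>
   realization \<rho> (\<Phi> \<bullet>\<^sub>N \<Psi>) x = realization \<rho> \<Phi> (realization \<rho> \<Psi> x)"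
proof (induction d n \<Psi> arbitrary: x rule: is_nn.induct)
  case (2 d n A' b')
  then obtain A b \<Phi>' where \<Phi>: "\<Phi> = (A, b) # \<Phi>'" by (cases \<Phi>) auto
  with 2 have A: "A \<in> carrier_mat (dim_vec b) n"
    by (cases "\<Phi>' = []") (auto simp: is_nn_Cons)
  have "A * A' *\<^sub>v x + (A *\<^sub>v b' + b) = A *\<^sub>v (A' *\<^sub>v x + b') + b"
    using 2 A by (subst mult_add_distrib_mat_vec[where nc = n and nr = "dim_vec b"])
      (auto simp: assoc_mult_mat_vec[where n\<^sub>1 = "dim_vec b" and n\<^sub>2 = n and n\<^sub>3 = d]
        intro!: assoc_add_vec[symmetric, where n = "dim_vec b"])
  then show ?case unfolding \<Phi> by (cases "\<Phi>' = []") (auto simp: nn_concat_single realization_Cons)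
next
  case (3 d n A b v va)
  have "map_vec \<rho> (A *\<^sub>v x + b) \<in> carrier_vec (dim_vec b)" by (intro carrier_vecI) simp
  with "3.IH" "3.prems"
  have "realization \<rho> (\<Phi> \<bullet>\<^sub>N (v # va)) (map_vec \<rho> (A *\<^sub>v x + b))
      = realization \<rho> \<Phi> (realization \<rho> (v # va) (map_vec \<rho> (A *\<^sub>v x + b)))"
    unfolding is_nn.simps by blast
  then show ?case
    by (simp only: nn_concat_Cons realization_Cons nn_concat_nonempty realization.simps list.simps
        not_False_eq_True)
qed auto

section \<open>Parallelization of networks\<close>

lemma length_FP2: "length (FP2 \<Phi> \<Psi>) = min (length \<Phi>) (length \<Psi>)"
  by (simp add: FP2_def)

lemma FP2_Cons: "FP2 ((A, b) # \<Phi>) ((A', b') # \<Psi>) = par_layer (A, b) (A', b') # FP2 \<Phi> \<Psi>"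
  by (simp add: FP2_def)

lemma FP2_eq_Nil_iff: "FP2 \<Phi> \<Psi> = [] \<longleftrightarrow> \<Phi> = [] \<or> \<Psi> = []"
  by (auto simp: FP2_def)

text \<open>Equal depths matter because \<open>map2\<close> would silently drop the surplus layers
  of the longer network.\<close>

lemma is_nn_FP2:
  "length \<Phi> = length \<Psi> \<Longrightarrow> is_nn d n \<Phi> \<Longrightarrow> is_nn d' n' \<Psi> \<Longrightarrow> is_nn (d + d') (n + n') (FP2 \<Phi> \<Psi>)"
proof (induction \<Phi> \<Psi> arbitrary: d d' rule: list_induct2)
  case (Cons x \<Phi> y \<Psi>)
  obtain A b A' b' where [simp]: "x = (A, b)" "y = (A', b')" by (cases x; cases y) auto
  from Cons.hyps have "\<Phi> = [] \<longleftrightarrow> \<Psi> = []" by auto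
  then show ?case using Cons
    by (cases "\<Phi> = []") (auto simp: FP2_Cons is_nn_Cons FP2_eq_Nil_iff FP2_def)
qed auto

lemma map_append_vec: "map_vec f (v @\<^sub>v w) = map_vec f v @\<^sub>v map_vec f w"
  by (rule eq_vecI) (auto simp: append_vec_def Let_def)

lemma realization_FP2:
  "length \<Phi> = length \<Psi> \<Longrightarrow> is_nn d n \<Phi> \<Longrightarrow> is_nn d' n' \<Psi> \<Longrightarrow>
   x \<in> carrier_vec d \<Longrightarrow> y \<in> carrier_vec d' \<Longrightarrow>
   realization \<rho> (FP2 \<Phi> \<Psi>) (x @\<^sub>v y) = realization \<rho> \<Phi> x @\<^sub>v realization \<rho> \<Psi> y"
proof (induction \<Phi> \<Psi> arbitrary: d d' x y rule: list_induct2)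
  case (Cons L \<Phi> L' \<Psi>)
  obtain A b A' b' where [simp]: "L = (A, b)" "L' = (A', b')" by (cases L; cases L') auto
  from Cons.hyps have e: "\<Phi> = [] \<longleftrightarrow> \<Psi> = []" by auto
  have c: "A \<in> carrier_mat (dim_vec b) d" "A' \<in> carrier_mat (dim_vec b') d'"
    using Cons.prems e by (cases "\<Phi> = []"; auto simp: is_nn_Cons)+
  have "four_block_mat A (0\<^sub>m (dim_row A) (dim_col A')) (0\<^sub>m (dim_row A') (dim_col A)) A' *\<^sub>v (x @\<^sub>v y)
      = (A *\<^sub>v x + 0\<^sub>m (dim_row A) (dim_col A') *\<^sub>v y) @\<^sub>v (0\<^sub>m (dim_row A') (dim_col A) *\<^sub>v x + A' *\<^sub>v y)"
    using c Cons.prems by (intro four_block_mat_mult_vec) auto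
  also have "0\<^sub>m (dim_row A) (dim_col A') *\<^sub>v y = 0\<^sub>v (dim_row A)"
    using c Cons.prems by auto
  also have "0\<^sub>m (dim_row A') (dim_col A) *\<^sub>v x = 0\<^sub>v (dim_row A')"
    using c Cons.prems by auto
  also have "A *\<^sub>v x + 0\<^sub>v (dim_row A) = A *\<^sub>v x" by (intro right_zero_vec carrier_vecI) simp
  also have "0\<^sub>v (dim_row A') + A' *\<^sub>v y = A' *\<^sub>v y" by (intro left_zero_vec carrier_vecI) simp
  finally have "four_block_mat A (0\<^sub>m (dim_row A) (dim_col A')) (0\<^sub>m (dim_row A') (dim_col A)) A'
        *\<^sub>v (x @\<^sub>v y) + (b @\<^sub>v b') = (A *\<^sub>v x + b) @\<^sub>v (A' *\<^sub>v y + b')"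
    by (simp only:) (use c in \<open>intro append_vec_add carrier_vecI; simp\<close>)
  note eq = this
  have m: "map_vec \<rho> (A *\<^sub>v x + b) \<in> carrier_vec (dim_vec b)"
    "map_vec \<rho> (A' *\<^sub>v y + b') \<in> carrier_vec (dim_vec b')" by (intro carrier_vecI, simp)+
  show ?case
  proof (cases "\<Phi> = []")
    case True
    with e eq show ?thesis by (simp add: FP2_def)
  next
    case False
    with e Cons.prems have "is_nn (dim_vec b) n \<Phi>" "is_nn (dim_vec b') n' \<Psi>"
      by (simp_all add: is_nn_Cons)
    from Cons.IH[OF this m] False e eq show ?thesis
      by (simp add: FP2_Cons realization_Cons FP2_eq_Nil_iff map_append_vec)
  qed
qed auto

lemma FP_Cons: "\<Phi>s \<noteq> [] \<Longrightarrow> FP (\<Phi> # \<Phi>s) = FP2 \<Phi> (FP \<Phi>s)"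
  by (cases \<Phi>s) auto

lemma length_FP_replicate: "n > 0 \<Longrightarrow> length (FP (replicate n \<Phi>)) = length \<Phi>"
proof (induction n)
  case (Suc n)
  then show ?case by (cases n) (auto simp: FP_Cons length_FP2)
qed auto

lemma is_nn_FP_replicate:
  "n > 0 \<Longrightarrow> is_nn d 1 \<Phi> \<Longrightarrow> is_nn (n * d) n (FP (replicate n \<Phi>))"
proof (induction n)
  case (Suc n)
  show ?case
  proof (cases "n = 0")
    case False
    with Suc have "is_nn (d + n * d) (1 + n) (FP2 \<Phi> (FP (replicate n \<Phi>)))"
      by (intro is_nn_FP2) (auto simp: length_FP_replicate)
    with False show ?thesis by (simp add: FP_Cons)
  qed (use Suc in simp)
qed auto

text \<open>Copy \<open>i\<close> reads the \<open>d\<close> consecutive entries from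
  \<open>i * d\<close> on. The case \<open>d = 1\<close> serves the identity blocks,
  \<open>d = 2\<close> the product blocks.\<close>

lemma realization_FP_replicate:
  "is_nn d 1 \<Phi> \<Longrightarrow> x \<in> carrier_vec (n * d) \<Longrightarrow> i < n \<Longrightarrow>
   realization \<rho> (FP (replicate n \<Phi>)) x $ i = realization \<rho> \<Phi> (vec d (\<lambda>j. x $ (i * d + j))) $ 0"
proof (induction n arbitrary: x i)
  case (Suc n)
  show ?case
  proof (cases "n = 0")
    case True
    with Suc.prems have "vec d (\<lambda>j. x $ (i * d + j)) = x" by auto
    with True Suc.prems show ?thesis by simp
  next
    case False
    define y z where "y = vec_first x d" and "z = vec_last x (n * d)"
    have x: "x = y @\<^sub>v z" and y: "y \<in> carrier_vec d" and z: "z \<in> carrier_vec (n * d)"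
      using Suc.prems by (simp_all add: y_def z_def)
    have R: "realization \<rho> (FP (replicate (Suc n) \<Phi>)) x
        = realization \<rho> \<Phi> y @\<^sub>v realization \<rho> (FP (replicate n \<Phi>)) z"
      using False Suc.prems y z
      by (simp add: FP_Cons x
          realization_FP2[where n = 1 and n' = n and d = d and d' = "n * d"]
          length_FP_replicate is_nn_FP_replicate[unfolded One_nat_def])
    have d1: "dim_vec (realization \<rho> \<Phi> y) = 1"
      using realization_dim[OF Suc.prems(1) y] by auto
    have d2: "dim_vec (realization \<rho> (FP (replicate n \<Phi>)) z) = n"
      using realization_dim[OF is_nn_FP_replicate[OF _ Suc.prems(1)] z] False by auto
    show ?thesis
    proof (cases i)
      case 0
      have "vec d (\<lambda>j. x $ (i * d + j)) = y" using y z 0 by (intro eq_vecI) (auto simp: x)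
      with 0 show ?thesis using d1 d2 by (simp add: R del: replicate.simps)
    next
      case (Suc i')
      \<comment> \<open>Keeps the shifted index within the range of the second part
        \<open>z\<close>, so that the entry of the appended vector is read there.\<close>
      have lt: "d + (i' * d + j) < d + n * d" if "j < d" for j
      proof -
        have "i' * d + j < Suc i' * d" using that by simp
        also have "\<dots> \<le> n * d" using \<open>i < Suc n\<close> Suc by (intro mult_le_mono1) simp
        finally show ?thesis by simp
      qed
      have "vec d (\<lambda>j. x $ (i * d + j)) = vec d (\<lambda>j. z $ (i' * d + j))"
        using y z Suc lt by (intro eq_vecI) (auto simp: x algebra_simps)
      moreover have "realization \<rho> (FP (replicate n \<Phi>)) z $ i'
          = realization \<rho> \<Phi> (vec d (\<lambda>j. z $ (i' * d + j))) $ 0"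
        using Suc.IH[OF Suc.prems(1) z] \<open>i < Suc n\<close> Suc by simp
      ultimately show ?thesis using Suc \<open>i < Suc n\<close> d1 d2 by (simp add: R del: replicate.simps)
    qed
  qed
qed auto

subsection \<open>Chebyshev polynomials\<close>

text \<open>By the cosine addition formulas the two sides agree at every cos t, hence on the
  infinite set [-1, 1], and are therefore the same polynomial. The identity of polynomials can be
  differentiated formally with \<open>pderiv\<close>.\<close>

lemma cheb_add:
  assumes "a \<le> b"
  shows "cheb (a + b) = 2 * cheb a * cheb b - cheb (b - a)"
proof (rule ccontr)
  let ?p = "cheb (a + b) - (2 * cheb a * cheb b - cheb (b - a))"
  assume "\<not> ?thesis"
  then have "finite {x. poly ?p x = 0}" by (intro poly_roots_finite) simp
  moreover have "poly ?p x = 0" if "x \<in> {-1..1}" for x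
  proof -
    define t where "t = arccos x"
    have x: "x = cos t" using that by (simp add: t_def)
    have "cos (real (a + b) * t) + cos (real (b - a) * t) = 2 * cos (real a * t) * cos (real b * t)"
      using assms by (simp add: of_nat_diff algebra_simps cos_add cos_diff)
    then show ?thesis by (simp add: x poly_cheb_cos)
  qed
  ultimately have "finite {-1..1::real}" by (rule_tac finite_subset) auto
  then show False using infinite_Icc[of "-1" "1::real"] by simp
qed

lemma abs_cheb_le_1: "\<bar>x\<bar> \<le> 1 \<Longrightarrow> \<bar>poly (cheb n) x\<bar> \<le> 1"
  using poly_cheb_cos[of n "arccos x"] by (simp add: cos_arccos_abs)

text \<open>The addition formula with both cosines bounded by 1. It supplies the second factor n in
  the n^2 bound for T_n'.\<close>

lemma abs_sin_nat_mult_le: "\<bar>sin (real n * t)\<bar> \<le> real n * \<bar>sin t\<bar>"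
proof (induction n)
  case (Suc n)
  have "sin (real (Suc n) * t) = sin (real n * t) * cos t + cos (real n * t) * sin t"
    by (simp add: sin_add algebra_simps)
  also have "\<bar>\<dots>\<bar> \<le> \<bar>sin (real n * t)\<bar> * \<bar>cos t\<bar> + \<bar>cos (real n * t)\<bar> * \<bar>sin t\<bar>"
    by (metis abs_mult abs_triangle_ineq)
  also have "\<dots> \<le> \<bar>sin (real n * t)\<bar> * 1 + 1 * \<bar>sin t\<bar>"
    by (intro add_mono mult_left_mono mult_right_mono) auto
  finally show ?case using Suc by (simp add: algebra_simps)
qed simp

text \<open>Differentiating T_n(cos t) = cos(n t) gives T_n'(cos t) sin t = n sin(n t). The strict
  bound on \<open>x\<close> makes sin t positive, so that it can be cancelled.\<close>

lemma abs_pderiv_cheb_le: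
  assumes "\<bar>x\<bar> < 1"
  shows "\<bar>poly (pderiv (cheb n)) x\<bar> \<le> (real n)\<^sup>2"
proof -
  define t where "t = arccos x"
  have x: "x = cos t" and s: "sin t > 0"
    using assms by (auto simp: t_def sin_arccos_abs abs_square_less_1)
  have "((\<lambda>s. poly (cheb n) (cos s)) has_real_derivative poly (pderiv (cheb n)) (cos t) * (- sin t)) (at t)"
    by (rule DERIV_chain2) (auto intro!: poly_DERIV derivative_eq_intros)
  moreover have "((\<lambda>s. cos (real n * s)) has_real_derivative - sin (real n * t) * real n) (at t)"
    by (auto intro!: derivative_eq_intros)
  ultimately have "poly (pderiv (cheb n)) x * sin t = real n * sin (real n * t)"
    using DERIV_unique by (fastforce simp: poly_cheb_cos x)
  then have "\<bar>poly (pderiv (cheb n)) x\<bar> * sin t = real n * \<bar>sin (real n * t)\<bar>"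
    using s by (metis abs_mult abs_of_nat abs_of_pos)
  also have "\<dots> \<le> real n * (real n * sin t)"
    using abs_sin_nat_mult_le[of n t] s by (intro mult_left_mono) auto
  finally show ?thesis using s by (simp add: power2_eq_square)
qed

subsection \<open>The Sobolev norm\<close>

text \<open>The set where the absolute value of \<open>F\<close> exceeds \<open>c\<close> is open by
  continuity and null by the essential bound, hence empty. This is what makes the block estimates
  usable on curves of measure zero.\<close>

lemma linf_norm_le_iff:
  fixes F :: "'a::euclidean_space \<Rightarrow> real"
  assumes D: "open D" and F: "continuous_on D F"
  shows "linf_norm D F \<le> ereal c \<longleftrightarrow> (\<forall>x\<in>D. \<bar>F x\<bar> \<le> c)"
proof
  have Dl: "D \<in> sets lebesgue" using D by simp
  assume le: "linf_norm D F \<le> ereal c"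
  have "AE x in lebesgue_on D. ereal \<bar>F x\<bar> \<le> linf_norm D F"
    unfolding linf_norm_def by (rule esssup_AE)
  then have "AE x in lebesgue_on D. \<bar>F x\<bar> \<le> c"
    by eventually_elim (use le in \<open>auto dest: order_trans\<close>)
  then have *: "AE x in lebesgue. x \<in> D \<longrightarrow> \<bar>F x\<bar> \<le> c"
    using Dl by (subst (asm) AE_restrict_space_iff) auto
  define S where "S = D \<inter> (\<lambda>x. \<bar>F x\<bar>) -` {c<..}"
  have "open S"
    unfolding S_def using D F by (intro continuous_open_preimage continuous_intros)
  moreover have "negligible S"
    unfolding negligible_iff_null_sets
  proof (subst AE_iff_null_sets)
    show "S \<in> sets lebesgue" using \<open>open S\<close> by simp
    show "AE x in lebesgue. x \<notin> S" using * by eventually_elim (auto simp: S_def)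
  qed
  ultimately have "S = {}" using open_not_negligible by blast
  then show "\<forall>x\<in>D. \<bar>F x\<bar> \<le> c" by (auto simp: S_def not_less)
next
  have Dl: "D \<in> sets lebesgue" using D by simp
  assume le: "\<forall>x\<in>D. \<bar>F x\<bar> \<le> c"
  have "(\<lambda>x. \<bar>F x\<bar>) \<in> borel_measurable (lebesgue_on D)"
    using F Dl by (intro continuous_imp_measurable_on_sets_lebesgue continuous_intros)
  then show "linf_norm D F \<le> ereal c"
    unfolding linf_norm_def using le Dl by (intro esssup_I AE_I2) (auto simp: space_restrict_space)
qed

lemma linf_norm_partial_deriv_le_iff:
  fixes F :: "'a::euclidean_space \<Rightarrow> real"
  assumes D: "open D"
    and F: "\<And>x. x \<in> D \<Longrightarrow> ((\<lambda>t. F (x + t *\<^sub>R e)) has_real_derivative F' x) (at 0)"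
    and F': "continuous_on D F'"
  shows "linf_norm D (partial_deriv e F) \<le> ereal c \<longleftrightarrow> (\<forall>x\<in>D. \<bar>F' x\<bar> \<le> c)"
proof -
  have eq: "partial_deriv e F x = F' x" if "x \<in> D" for x
    unfolding partial_deriv_def using F[OF that] by (rule DERIV_imp_deriv)
  then have "continuous_on D (partial_deriv e F)"
    using F' by (subst continuous_on_cong[OF refl]) auto
  then show ?thesis using linf_norm_le_iff[OF D] eq by auto
qed

text \<open>The only basis vector is 1, so the single partial derivative is the ordinary derivative
  after a shift of the argument.\<close>

lemma w1inf_norm_real_le_iff:
  fixes F :: "real \<Rightarrow> real"
  assumes D: "open D"
    and F: "\<And>x. x \<in> D \<Longrightarrow> (F has_real_derivative F' x) (at x)"
    and F': "continuous_on D F'"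
  shows "w1inf_norm D F \<le> ereal c \<longleftrightarrow> (\<forall>x\<in>D. \<bar>F x\<bar> \<le> c \<and> \<bar>F' x\<bar> \<le> c)"
proof -
  have "continuous_on D F"
    by (rule DERIV_continuous_on[where D = F']) (rule has_field_derivative_at_within[OF F])
  moreover have "((\<lambda>t. F (x + t *\<^sub>R 1)) has_real_derivative F' x) (at 0)" if "x \<in> D" for x
  proof -
    have "(F has_real_derivative F' x) (at (0 + x))" using F[OF that] by simp
    then have "((\<lambda>t. F (t + x)) has_real_derivative F' x) (at 0)" by (rule DERIV_shift[THEN iffD1])
    then show ?thesis unfolding real_scaleR_def mult_1_right add.commute[of x] .
  qed
  ultimately have "linf_norm D F \<le> ereal c \<longleftrightarrow> (\<forall>x\<in>D. \<bar>F x\<bar> \<le> c)"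
    and "linf_norm D (partial_deriv 1 F) \<le> ereal c \<longleftrightarrow> (\<forall>x\<in>D. \<bar>F' x\<bar> \<le> c)"
    using linf_norm_le_iff[OF D] linf_norm_partial_deriv_le_iff[OF D _ F'] by blast+
  then show ?thesis unfolding w1inf_norm_def Basis_real_def by auto
qed

lemma w1inf_norm_real2_le_iff:
  fixes F :: "real \<times> real \<Rightarrow> real"
  assumes D: "open D" and cF: "continuous_on D F"
    and F1: "\<And>x. x \<in> D \<Longrightarrow> ((\<lambda>t. F (x + t *\<^sub>R (1, 0))) has_real_derivative F1 x) (at 0)"
    and F2: "\<And>x. x \<in> D \<Longrightarrow> ((\<lambda>t. F (x + t *\<^sub>R (0, 1))) has_real_derivative F2 x) (at 0)"
    and F': "continuous_on D F1" "continuous_on D F2"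
  shows "w1inf_norm D F \<le> ereal c \<longleftrightarrow> (\<forall>x\<in>D. \<bar>F x\<bar> \<le> c \<and> \<bar>F1 x\<bar> \<le> c \<and> \<bar>F2 x\<bar> \<le> c)"
proof -
  have B: "(Basis :: (real \<times> real) set) = {(1, 0), (0, 1)}" by (auto simp: Basis_prod_def)
  have "w1inf_norm D F \<le> ereal c \<longleftrightarrow> linf_norm D F \<le> ereal c \<and>
      linf_norm D (partial_deriv (1, 0) F) \<le> ereal c \<and> linf_norm D (partial_deriv (0, 1) F) \<le> ereal c"
    unfolding w1inf_norm_def B by simp
  also have "\<dots> \<longleftrightarrow> (\<forall>x\<in>D. \<bar>F x\<bar> \<le> c) \<and> (\<forall>x\<in>D. \<bar>F1 x\<bar> \<le> c) \<and> (\<forall>x\<in>D. \<bar>F2 x\<bar> \<le> c)"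
    using linf_norm_le_iff[OF D cF] linf_norm_partial_deriv_le_iff[OF D F1 F'(1)]
      linf_norm_partial_deriv_le_iff[OF D F2 F'(2)] by simp
  finally show ?thesis by blast
qed

subsection \<open>Building blocks as smooth functions\<close>

text \<open>One hidden layer gives a finite sum of activated affine functions, a form in which
  differentiability is evident.\<close>

lemma realization_depth_2:
  assumes "is_nn d 1 \<Phi>" and "length \<Phi> = 2"
  obtains N :: nat and w a b c where
    "\<And>x. x \<in> carrier_vec d \<Longrightarrow>
       realization \<rho> \<Phi> x $ 0 = (\<Sum>i<N. w i * \<rho> ((\<Sum>j<d. a i j * x $ j) + b i)) + c"
proof -
  obtain A b A' b' where \<Phi>: "\<Phi> = [(A, b), (A', b')]"
    and A: "A \<in> carrier_mat (dim_vec b) d" "A' \<in> carrier_mat 1 (dim_vec b)" "b' \<in> carrier_vec 1"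
    using is_nn_length_2D[OF assms] .
  have "realization \<rho> \<Phi> x $ 0 =
      (\<Sum>i<dim_vec b. A' $$ (0, i) * \<rho> ((\<Sum>j<d. A $$ (i, j) * x $ j) + b $ i)) + b' $ 0"
    if "x \<in> carrier_vec d" for x
    using A that by (simp add: \<Phi> scalar_prod_def atLeast0LessThan)
  then show thesis by (rule that)
qed

text \<open>The derivative is the termwise one, from tanh' = 1 - tanh^2. Smoothness holds on the
  whole line, the error bounds only inside (-B, B).\<close>

lemma id_block_smoothE:
  assumes "id_block C \<tau> B \<Phi>"
  obtains f' where
    "\<And>x. ((\<lambda>x. realization tanh \<Phi> (vec_of_list [x]) $ 0) has_real_derivative f' x) (at x)"
    "continuous_on UNIV f'"
    "\<And>x. \<bar>x\<bar> < B \<Longrightarrow> \<bar>x - realization tanh \<Phi> (vec_of_list [x]) $ 0\<bar> \<le> \<tau> \<and> \<bar>1 - f' x\<bar> \<le> \<tau>"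
proof -
  let ?F = "\<lambda>x. realization tanh \<Phi> (vec_of_list [x]) $ 0"
  have nn: "is_nn 1 1 \<Phi>" and len: "length \<Phi> = 2"
    using assms by (auto simp: id_block_def depth_def)
  obtain N w a b c where eq: "\<And>x. x \<in> carrier_vec 1 \<Longrightarrow> realization tanh \<Phi> x $ 0 =
      (\<Sum>i<N::nat. w i * tanh ((\<Sum>j<1. a i j * x $ j) + b i)) + c"
    by (rule realization_depth_2[OF nn len, of tanh]) (rule that)
  have F: "?F x = (\<Sum>i<N. w i * tanh (a i 0 * x + b i)) + c" for x
  proof (subst eq)
    show "vec_of_list [x] \<in> carrier_vec 1" by (intro carrier_vecI) simp
  qed (simp add: vec_of_list_index del: vec_of_list_Cons)
  define f' where "f' x = (\<Sum>i<N. w i * ((1 - (tanh (a i 0 * x + b i))\<^sup>2) * a i 0))" for x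
  have d: "(?F has_real_derivative f' x) (at x)" for x
    unfolding F f'_def
    by (auto intro!: derivative_eq_intros sum.cong)
  have c: "continuous_on UNIV f'"
    unfolding f'_def by (intro continuous_intros) auto
  have "w1inf_norm {-B<..<B} (\<lambda>x. x - ?F x) \<le> ereal \<tau> \<longleftrightarrow>
     (\<forall>x\<in>{-B<..<B}. \<bar>x - ?F x\<bar> \<le> \<tau> \<and> \<bar>1 - f' x\<bar> \<le> \<tau>)"
    by (rule w1inf_norm_real_le_iff)
      (auto intro!: derivative_intros d continuous_intros continuous_on_subset[OF c]
        simp del: vec_of_list_Cons)
  with assms have "\<forall>x\<in>{-B<..<B}. \<bar>x - ?F x\<bar> \<le> \<tau> \<and> \<bar>1 - f' x\<bar> \<le> \<tau>"
    by (simp add: id_block_def)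
  then show thesis by (intro that[OF d c]) (simp add: abs_less_iff del: vec_of_list_Cons)
qed

text \<open>The functions \<open>p1\<close> and \<open>p2\<close> are the two partial derivatives of
  the block. The first clause states the chain rule along arbitrary differentiable curves, which is
  the form needed for x -> P(f x, g x) and avoids derivatives in the plane.\<close>

lemma prod_block_smoothE:
  assumes "prod_block C \<tau> B \<Phi>"
  obtains p1 p2 where
    "\<And>u v u' v' t. (u has_real_derivative u') (at t) \<Longrightarrow> (v has_real_derivative v') (at t) \<Longrightarrow>
       ((\<lambda>s. realization tanh \<Phi> (vec_of_list [u s, v s]) $ 0) has_real_derivative
         p1 (u t, v t) * u' + p2 (u t, v t) * v') (at t)"
    "continuous_on UNIV p1" "continuous_on UNIV p2"
    "\<And>x y. \<bar>x\<bar> < B \<Longrightarrow> \<bar>y\<bar> < B \<Longrightarrow> \<bar>x * y - realization tanh \<Phi> (vec_of_list [x, y]) $ 0\<bar> \<le> \<tau> \<and>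
       \<bar>y - p1 (x, y)\<bar> \<le> \<tau> \<and> \<bar>x - p2 (x, y)\<bar> \<le> \<tau>"
proof -
  let ?P = "\<lambda>x y. realization tanh \<Phi> (vec_of_list [x, y]) $ 0"
  have nn: "is_nn 2 1 \<Phi>" and len: "length \<Phi> = 2"
    using assms by (auto simp: prod_block_def depth_def)
  obtain N w a b c where eq: "\<And>x. x \<in> carrier_vec 2 \<Longrightarrow> realization tanh \<Phi> x $ 0 =
      (\<Sum>i<N::nat. w i * tanh ((\<Sum>j<2. a i j * x $ j) + b i)) + c"
    by (rule realization_depth_2[OF nn len, of tanh]) (rule that)
  have P: "?P x y = (\<Sum>i<N. w i * tanh (a i 0 * x + a i 1 * y + b i)) + c" for x y
  proof (subst eq)
    show "vec_of_list [x, y] \<in> carrier_vec 2" by (intro carrier_vecI) simp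
  qed (simp add: vec_of_list_index numeral_2_eq_2 del: vec_of_list_Cons)
  define q where "q j z = (\<Sum>i<N. w i * ((1 - (tanh (a i 0 * fst z + a i 1 * snd z + b i))\<^sup>2) * a i j))"
    for j :: nat and z :: "real \<times> real"
  have d: "((\<lambda>s. ?P (u s) (v s)) has_real_derivative q 0 (u t, v t) * u' + q 1 (u t, v t) * v') (at t)"
    if [derivative_intros]: "(u has_real_derivative u') (at t)" "(v has_real_derivative v') (at t)"
    for u v u' v' t
  proof -
    have "q 0 (u t, v t) * u' + q 1 (u t, v t) * v' =
        (\<Sum>i<N. w i * ((1 - (tanh (a i 0 * u t + a i 1 * v t + b i))\<^sup>2) * (a i 0 * u' + a i 1 * v')))"
      unfolding q_def sum_distrib_right sum.distrib[symmetric] by (simp add: algebra_simps)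
    then show ?thesis unfolding P by (auto intro!: derivative_eq_intros sum.cong)
  qed
  have c: "continuous_on UNIV (q j)" for j
    unfolding q_def by (intro continuous_intros) auto
  have cP: "continuous_on UNIV (\<lambda>(x, y). x * y - ?P x y)"
    unfolding P case_prod_beta by (intro continuous_intros) auto
  have "w1inf_norm ({-B<..<B} \<times> {-B<..<B}) (\<lambda>(x, y). x * y - ?P x y) \<le> ereal \<tau> \<longleftrightarrow>
     (\<forall>z\<in>{-B<..<B} \<times> {-B<..<B}. \<bar>(\<lambda>(x, y). x * y - ?P x y) z\<bar> \<le> \<tau> \<and>
        \<bar>snd z - q 0 z\<bar> \<le> \<tau> \<and> \<bar>fst z - q 1 z\<bar> \<le> \<tau>)"
  proof (rule w1inf_norm_real2_le_iff)
    show "continuous_on ({-B<..<B} \<times> {-B<..<B}) (\<lambda>(x, y). x * y - ?P x y)"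
      by (rule continuous_on_subset[OF cP]) simp
  next
    fix z :: "real \<times> real"
    obtain x y where z: "z = (x, y)" by (cases z)
    \<comment> \<open>The chain rule \<open>d\<close> along a coordinate line, with velocities 1 and
      0, yields the partial derivative that enters the norm.\<close>
    have "((\<lambda>t. (x + t) * y - ?P (x + t) y) has_real_derivative
        y - (q 0 (x + 0, y) * 1 + q 1 (x + 0, y) * 0)) (at 0)"
      by (rule d derivative_eq_intros refl)+ simp
    then show "((\<lambda>t. (\<lambda>(x, y). x * y - ?P x y) (z + t *\<^sub>R (1, 0))) has_real_derivative
        snd z - q 0 z) (at 0)"
      by (simp add: z)
    have "((\<lambda>t. x * (y + t) - ?P x (y + t)) has_real_derivative
        x - (q 0 (x, y + 0) * 0 + q 1 (x, y + 0) * 1)) (at 0)"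
      by (rule d derivative_eq_intros refl)+ simp
    then show "((\<lambda>t. (\<lambda>(x, y). x * y - ?P x y) (z + t *\<^sub>R (0, 1))) has_real_derivative
        fst z - q 1 z) (at 0)"
      by (simp add: z)
  qed (auto intro!: open_Times continuous_intros continuous_on_subset[OF c])
  with assms have *: "\<forall>z\<in>{-B<..<B} \<times> {-B<..<B}. \<bar>(\<lambda>(x, y). x * y - ?P x y) z\<bar> \<le> \<tau> \<and>
        \<bar>snd z - q 0 z\<bar> \<le> \<tau> \<and> \<bar>fst z - q 1 z\<bar> \<le> \<tau>"
    by (simp add: prod_block_def)
  show thesis
  proof (rule that[OF d c c])
    fix x y :: real assume "\<bar>x\<bar> < B" "\<bar>y\<bar> < B"
    then have "(x, y) \<in> {-B<..<B} \<times> {-B<..<B}" by auto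
    from bspec[OF * this] show "\<bar>x * y - ?P x y\<bar> \<le> \<tau> \<and> \<bar>y - q 0 (x, y)\<bar> \<le> \<tau> \<and> \<bar>x - q 1 (x, y)\<bar> \<le> \<tau>"
      by (simp only: case_prod_conv fst_conv snd_conv)
  qed
qed

subsection \<open>Error propagation\<close>

text \<open>The invariant of the recursion. It strengthens the bound on the norm over (-1, 1): the
  inequalities hold at every point, and \<open>f\<close> is C^1 on the whole line, so that it can be
  composed with the blocks.\<close>

definition cheb_approx :: "real \<Rightarrow> nat \<Rightarrow> (real \<Rightarrow> real) \<Rightarrow> bool" where
  "cheb_approx \<delta> k f \<longleftrightarrow> (\<exists>f'. (\<forall>x. (f has_real_derivative f' x) (at x)) \<and> continuous_on UNIV f' \<and>
     (\<forall>x. \<bar>x\<bar> < 1 \<longrightarrow> \<bar>poly (cheb k) x - f x\<bar> \<le> \<delta> \<and> \<bar>poly (pderiv (cheb k)) x - f' x\<bar> \<le> \<delta>))"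

lemma w1inf_norm_cheb_approx:
  assumes "cheb_approx \<delta> k f"
  shows "w1inf_norm {-1<..<1} (\<lambda>x. poly (cheb k) x - f x) \<le> ereal \<delta>"
proof -
  obtain f' where f': "\<And>x. (f has_real_derivative f' x) (at x)" "continuous_on UNIV f'"
    and b: "\<And>x. \<bar>x\<bar> < 1 \<Longrightarrow> \<bar>poly (cheb k) x - f x\<bar> \<le> \<delta> \<and> \<bar>poly (pderiv (cheb k)) x - f' x\<bar> \<le> \<delta>"
    using assms unfolding cheb_approx_def by blast
  have "w1inf_norm {-1<..<1} (\<lambda>x. poly (cheb k) x - f x) \<le> ereal \<delta> \<longleftrightarrow>
    (\<forall>x\<in>{-1<..<1}. \<bar>poly (cheb k) x - f x\<bar> \<le> \<delta> \<and> \<bar>poly (pderiv (cheb k)) x - f' x\<bar> \<le> \<delta>)"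
    by (rule w1inf_norm_real_le_iff)
      (auto intro!: DERIV_diff poly_DERIV f' continuous_intros continuous_on_subset[OF f'(2)])
  with b show ?thesis by (auto simp: abs_less_iff)
qed

text \<open>Writes the difference as a (b - b') + (a - a') b'. The bounds are asymmetric on purpose:
  \<open>A\<close> bounds an exact factor such as T_k', and \<open>B\<close> an approximate
  one.\<close>

lemma abs_mult_diff_le:
  fixes a b a' b' :: real
  assumes "\<bar>a - a'\<bar> \<le> \<alpha>" and "\<bar>b - b'\<bar> \<le> \<beta>" and "\<bar>a\<bar> \<le> A" and "\<bar>b'\<bar> \<le> B"
  shows "\<bar>a * b - a' * b'\<bar> \<le> A * \<beta> + \<alpha> * B"
proof -
  have "a * b - a' * b' = a * (b - b') + (a - a') * b'" by (simp add: algebra_simps)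
  also have "\<bar>\<dots>\<bar> \<le> \<bar>a\<bar> * \<bar>b - b'\<bar> + \<bar>a - a'\<bar> * \<bar>b'\<bar>"
    by (metis abs_mult abs_triangle_ineq)
  also have "\<dots> \<le> A * \<beta> + \<alpha> * B"
    using assms by (intro add_mono mult_mono) auto
  finally show ?thesis .
qed

lemma abs_twice_add_diff_le:
  fixes a b c a' b' c' :: real
  assumes "\<bar>a - a'\<bar> \<le> \<alpha>" and "\<bar>b - b'\<bar> \<le> \<beta>" and "\<bar>c - c'\<bar> \<le> \<gamma>"
  shows "\<bar>2 * (a + b) - c - (2 * (a' + b') - c')\<bar> \<le> 2 * (\<alpha> + \<beta>) + \<gamma>"
  using assms by (auto simp: abs_le_iff)

text \<open>Values lose one \<theta> from \<open>f\<close> and one from the block. For the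
  derivative, T_k' is at most k^2 and the slope g' of the block at most 1 + \<theta> < 2, which
  gives k^2 \<theta> + 2 \<theta>.\<close>

lemma cheb_approx_id:
  assumes \<Phi>: "id_block C \<theta> 2 \<Phi>" and f: "cheb_approx \<theta> k f" and \<theta>: "0 < \<theta>" "\<theta> < 1"
  shows "cheb_approx (((real k)\<^sup>2 + 2) * \<theta>) k (\<lambda>x. realization tanh \<Phi> (vec_of_list [f x]) $ 0)"
proof -
  obtain f' where f': "\<And>x. (f has_real_derivative f' x) (at x)" "continuous_on UNIV f'"
    and b: "\<And>x. \<bar>x\<bar> < 1 \<Longrightarrow> \<bar>poly (cheb k) x - f x\<bar> \<le> \<theta> \<and> \<bar>poly (pderiv (cheb k)) x - f' x\<bar> \<le> \<theta>"
    using f unfolding cheb_approx_def by blast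
  let ?I = "\<lambda>x. realization tanh \<Phi> (vec_of_list [x]) $ 0"
  obtain g' where g': "\<And>x. (?I has_real_derivative g' x) (at x)" "continuous_on UNIV g'"
    and c: "\<And>x. \<bar>x\<bar> < 2 \<Longrightarrow> \<bar>x - ?I x\<bar> \<le> \<theta> \<and> \<bar>1 - g' x\<bar> \<le> \<theta>"
    using id_block_smoothE[OF \<Phi>] by blast
  have cf: "continuous_on UNIV f" using f'(1) by (intro DERIV_continuous_on) auto
  show ?thesis unfolding cheb_approx_def
  proof (intro exI[of _ "\<lambda>x. g' (f x) * f' x"] conjI allI impI)
    show "((\<lambda>x. ?I (f x)) has_real_derivative g' (f x) * f' x) (at x)" for x
      by (rule DERIV_chain2[OF g'(1) f'(1)])
    show "continuous_on UNIV (\<lambda>x. g' (f x) * f' x)"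
      by (intro continuous_on_mult f'(2) continuous_on_compose2[OF g'(2) cf]) auto
  next
    fix x :: real assume x: "\<bar>x\<bar> < 1"
    have T: "\<bar>poly (cheb k) x\<bar> \<le> 1" "\<bar>poly (pderiv (cheb k)) x\<bar> \<le> (real k)\<^sup>2"
      using abs_cheb_le_1[of x k] abs_pderiv_cheb_le[OF x, of k] x by auto
    have fx: "\<bar>f x\<bar> < 2" using b[OF x] T \<theta> by linarith
    have "\<bar>poly (cheb k) x - ?I (f x)\<bar> \<le> 2 * \<theta>" using b[OF x] c[OF fx] by linarith
    also have "\<dots> \<le> ((real k)\<^sup>2 + 2) * \<theta>" using \<theta> by (intro mult_right_mono) auto
    finally show "\<bar>poly (cheb k) x - ?I (f x)\<bar> \<le> ((real k)\<^sup>2 + 2) * \<theta>" .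
    have "\<bar>poly (pderiv (cheb k)) x * 1 - f' x * g' (f x)\<bar> \<le> (real k)\<^sup>2 * \<theta> + \<theta> * 2"
      using b[OF x] c[OF fx] T \<theta> by (intro abs_mult_diff_le) auto
    then show "\<bar>poly (pderiv (cheb k)) x - g' (f x) * f' x\<bar> \<le> ((real k)\<^sup>2 + 2) * \<theta>"
      by (simp add: algebra_simps)
  qed
qed

lemma cheb_approx_mono: "cheb_approx \<delta> k f \<Longrightarrow> \<delta> \<le> \<delta>' \<Longrightarrow> cheb_approx \<delta>' k f"
  unfolding cheb_approx_def by (meson order_trans)

lemma cheb_approx_one: "0 \<le> \<delta> \<Longrightarrow> cheb_approx \<delta> 0 (\<lambda>x. 1)"
  unfolding cheb_approx_def by (intro exI[of _ "\<lambda>x. 0"]) auto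

text \<open>The subtracted function \<open>h\<close> stays general because T_(b-a) is the exact
  constant 1 when a = b and an approximation of T_1 when b = a + 1. The value error of the product
  is at most 4 \<theta>. The derivative error dominates: its two summands contribute 2 a^2 \<theta>
  + 3 \<theta> and 2 b^2 \<theta> + 3 \<theta>, and the recurrence doubles their sum.\<close>

lemma cheb_approx_prod:
  assumes \<Phi>: "prod_block C \<theta> 2 \<Phi>" and \<theta>: "0 < \<theta>" "\<theta> < 1" and ab: "a \<le> b"
    and f: "cheb_approx \<theta> a f" and g: "cheb_approx \<theta> b g" and h: "cheb_approx \<eta> (b - a) h"
  shows "cheb_approx (2 * (2 * ((real a)\<^sup>2 + (real b)\<^sup>2 + 3) * \<theta>) + \<eta>) (a + b)
    (\<lambda>x. 2 * realization tanh \<Phi> (vec_of_list [f x, g x]) $ 0 - h x)"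
proof -
  obtain f' where f': "\<And>x. (f has_real_derivative f' x) (at x)" "continuous_on UNIV f'"
    and bf: "\<And>x. \<bar>x\<bar> < 1 \<Longrightarrow> \<bar>poly (cheb a) x - f x\<bar> \<le> \<theta> \<and> \<bar>poly (pderiv (cheb a)) x - f' x\<bar> \<le> \<theta>"
    using f unfolding cheb_approx_def by blast
  obtain g' where g': "\<And>x. (g has_real_derivative g' x) (at x)" "continuous_on UNIV g'"
    and bg: "\<And>x. \<bar>x\<bar> < 1 \<Longrightarrow> \<bar>poly (cheb b) x - g x\<bar> \<le> \<theta> \<and> \<bar>poly (pderiv (cheb b)) x - g' x\<bar> \<le> \<theta>"
    using g unfolding cheb_approx_def by blast
  obtain h' where h': "\<And>x. (h has_real_derivative h' x) (at x)" "continuous_on UNIV h'"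
    and bh: "\<And>x. \<bar>x\<bar> < 1 \<Longrightarrow> \<bar>poly (cheb (b - a)) x - h x\<bar> \<le> \<eta> \<and>
      \<bar>poly (pderiv (cheb (b - a))) x - h' x\<bar> \<le> \<eta>"
    using h unfolding cheb_approx_def by blast
  let ?P = "\<lambda>x y. realization tanh \<Phi> (vec_of_list [x, y]) $ 0"
  obtain p1 p2 where
    p: "\<And>u v u' v' t. (u has_real_derivative u') (at t) \<Longrightarrow> (v has_real_derivative v') (at t) \<Longrightarrow>
       ((\<lambda>s. ?P (u s) (v s)) has_real_derivative p1 (u t, v t) * u' + p2 (u t, v t) * v') (at t)"
    and cp: "continuous_on UNIV p1" "continuous_on UNIV p2"
    and bp: "\<And>x y. \<bar>x\<bar> < 2 \<Longrightarrow> \<bar>y\<bar> < 2 \<Longrightarrow> \<bar>x * y - ?P x y\<bar> \<le> \<theta> \<and>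
       \<bar>y - p1 (x, y)\<bar> \<le> \<theta> \<and> \<bar>x - p2 (x, y)\<bar> \<le> \<theta>"
    by (rule prod_block_smoothE[OF \<Phi>]) (rule that)
  have cf: "continuous_on UNIV f" "continuous_on UNIV g"
    using f'(1) g'(1) by (auto intro!: DERIV_continuous_on)
  let ?s = "2 * ((real a)\<^sup>2 + (real b)\<^sup>2 + 3) * \<theta>"
  have p': "((\<lambda>x. ?P (f x) (g x)) has_real_derivative f' x * p1 (f x, g x) + g' x * p2 (f x, g x)) (at x)"
    for x using p[OF f'(1) g'(1), of x] by (simp only: mult.commute)
  let ?F' = "\<lambda>x. 2 * (f' x * p1 (f x, g x) + g' x * p2 (f x, g x)) - h' x"
  have T: "cheb (a + b) = 2 * cheb a * cheb b - cheb (b - a)" by (rule cheb_add[OF ab])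
  show ?thesis unfolding cheb_approx_def
  proof (intro exI[of _ ?F'] conjI allI impI)
    fix x :: real
    show "((\<lambda>x. 2 * ?P (f x) (g x) - h x) has_real_derivative ?F' x) (at x)"
      by (intro DERIV_diff DERIV_cmult p' h')
  next
    have "continuous_on UNIV (\<lambda>x. p1 (f x, g x))" "continuous_on UNIV (\<lambda>x. p2 (f x, g x))"
      by (rule continuous_on_compose2[OF cp(1)] continuous_on_compose2[OF cp(2)],
          intro continuous_on_Pair cf, simp)+
    then show "continuous_on UNIV ?F'"
      by (intro continuous_on_diff continuous_on_add continuous_on_mult continuous_on_const f' g' h')
  next
    fix x :: real assume x: "\<bar>x\<bar> < 1"
    have Tb: "\<bar>poly (cheb n) x\<bar> \<le> 1" "\<bar>poly (pderiv (cheb n)) x\<bar> \<le> (real n)\<^sup>2" for n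
      using abs_cheb_le_1[of x n] abs_pderiv_cheb_le[OF x, of n] x by auto
    have fg: "\<bar>f x\<bar> < 2" "\<bar>g x\<bar> < 2" using bf[OF x] bg[OF x] Tb(1)[of a] Tb(1)[of b] \<theta> by linarith+
    note bp = bp[OF fg]
    have "\<bar>poly (cheb a) x * poly (cheb b) x - f x * g x\<bar> \<le> 1 * \<theta> + \<theta> * 2"
      using bf[OF x] bg[OF x] Tb fg by (intro abs_mult_diff_le) auto
    then have "\<bar>poly (cheb a) x * poly (cheb b) x - ?P (f x) (g x)\<bar> \<le> 4 * \<theta>"
      using bp by linarith
    moreover have "4 * \<theta> \<le> ?s" using \<theta> by (auto intro!: mult_right_mono)
    moreover have "poly (cheb (a + b)) x =
        2 * (poly (cheb a) x * poly (cheb b) x) - poly (cheb (b - a)) x"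
      by (simp add: T)
    ultimately show "\<bar>poly (cheb (a + b)) x - (2 * ?P (f x) (g x) - h x)\<bar> \<le> 2 * ?s + \<eta>"
      using bh[OF x] unfolding abs_le_iff by linarith
    \<comment> \<open>The partial derivative of x y in the first slot is the second factor, so
      \<open>p1\<close> approximates T_b and \<open>p2\<close> approximates T_a. One \<theta> comes
      from the block, one from the argument; with \<theta> < 1 this also gives the bound 3
      below.\<close>
    have pT: "\<bar>poly (cheb b) x - p1 (f x, g x)\<bar> \<le> 2 * \<theta>" "\<bar>poly (cheb a) x - p2 (f x, g x)\<bar> \<le> 2 * \<theta>"
      using bf[OF x] bg[OF x] bp unfolding abs_le_iff by linarith+
    then have p3: "\<bar>p1 (f x, g x)\<bar> \<le> 3" "\<bar>p2 (f x, g x)\<bar> \<le> 3"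
      using Tb(1)[of a] Tb(1)[of b] \<theta> unfolding abs_le_iff by linarith+
    have "\<bar>poly (pderiv (cheb a)) x * poly (cheb b) x - f' x * p1 (f x, g x)\<bar> \<le>
        (real a)\<^sup>2 * (2 * \<theta>) + \<theta> * 3"
      using bf[OF x] bg[OF x] Tb pT p3 by (intro abs_mult_diff_le) auto
    moreover have "\<bar>poly (pderiv (cheb b)) x * poly (cheb a) x - g' x * p2 (f x, g x)\<bar> \<le>
        (real b)\<^sup>2 * (2 * \<theta>) + \<theta> * 3"
      using bf[OF x] bg[OF x] Tb pT p3 by (intro abs_mult_diff_le) auto
    moreover have "\<bar>poly (pderiv (cheb (b - a))) x - h' x\<bar> \<le> \<eta>" using bh[OF x] by simp
    ultimately have "\<bar>2 * (poly (pderiv (cheb a)) x * poly (cheb b) x + poly (pderiv (cheb b)) x * poly (cheb a) x)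
        - poly (pderiv (cheb (b - a))) x - ?F' x\<bar>
        \<le> 2 * ((real a)\<^sup>2 * (2 * \<theta>) + \<theta> * 3 + ((real b)\<^sup>2 * (2 * \<theta>) + \<theta> * 3)) + \<eta>"
      by (rule abs_twice_add_diff_le)
    also have "(real a)\<^sup>2 * (2 * \<theta>) + \<theta> * 3 + ((real b)\<^sup>2 * (2 * \<theta>) + \<theta> * 3) = ?s"
      by (simp add: algebra_simps)
    also have "2 * (poly (pderiv (cheb a)) x * poly (cheb b) x + poly (pderiv (cheb b)) x * poly (cheb a) x)
        - poly (pderiv (cheb (b - a))) x = poly (pderiv (cheb (a + b))) x"
      by (simp add: T pderiv_mult pderiv_diff algebra_simps)
    finally show "\<bar>poly (pderiv (cheb (a + b))) x - ?F' x\<bar> \<le> 2 * ?s + \<eta>" .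
  qed
qed

subsection \<open>The recursion step\<close>

text \<open>Identifies the least power of two that is at least m from the dyadic interval containing
  m, so later arguments never meet the \<open>LEAST\<close> operator.\<close>

lemma mtilde_eq:
  assumes "2 ^ k < m" and "m \<le> 2 ^ Suc k"
  shows "mtilde m = 2 ^ Suc k"
  unfolding mtilde_def
proof (rule Least_equality)
  fix n assume "m \<le> n \<and> (\<exists>l. n = 2 ^ l)"
  then obtain l where l: "n = 2 ^ l" "m \<le> 2 ^ l" by blast
  with assms(1) have "(2::nat) ^ k < 2 ^ l" by linarith
  then have "k < l" by simp
  then have "(2::nat) ^ Suc k \<le> 2 ^ l" by (intro power_increasing) auto
  with l show "2 ^ Suc k \<le> n" by simp
qed (use assms in blast)

lemma cheb_nn_2:
  "cheb_nn Id1 Prd 2 \<delta> =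
     [(mat_of_rows_list 2 [[1, 0], [0, 2]], vec_of_list [0, -1])]
     \<bullet>\<^sub>N FP2 (Id1 \<delta> 1) (Prd (\<delta> / 4) 1)
     \<bullet>\<^sub>N [(mat_of_rows_list 1 [[1], [1], [1]], 0\<^sub>v 3)]"
  by (subst cheb_nn.simps) simp

lemma cheb_nn_step:
  assumes "2 < m" and "mtilde m = 2 * h" and "\<theta> = \<delta> / (4 * (real m)\<^sup>2)"
  shows "cheb_nn Id1 Prd m \<delta> =
    [(cheb_A2 m, cheb_b2 m)] \<bullet>\<^sub>N FP (FP (replicate h (Id1 \<theta> 2)) # replicate (m - h) (Prd \<theta> 2))
      \<bullet>\<^sub>N [(cheb_A1 m, cheb_b1 m)] \<bullet>\<^sub>N cheb_nn Id1 Prd h \<theta>"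
  using assms by (subst cheb_nn.simps) (simp add: Let_def id_nn_def)

text \<open>Fixes the wiring of a level: the first \<open>h\<close> inputs feed one identity each,
  and the remaining ones are consumed in consecutive pairs by the products.\<close>

lemma FP_id_prod:
  assumes I: "is_nn 1 1 I" and Q: "is_nn 2 1 Q" and len: "length I = length Q" and pos: "0 < h" "0 < n"
  shows is_nn_FP_id_prod: "is_nn (h + 2 * n) (h + n) (FP (FP (replicate h I) # replicate n Q))"
    and length_FP_id_prod: "length (FP (FP (replicate h I) # replicate n Q)) = length I"
    and realization_FP_id: "x \<in> carrier_vec (h + 2 * n) \<Longrightarrow> i < h \<Longrightarrow>
      realization \<rho> (FP (FP (replicate h I) # replicate n Q)) x $ i = realization \<rho> I (vec_of_list [x $ i]) $ 0"
    and realization_FP_prod: "x \<in> carrier_vec (h + 2 * n) \<Longrightarrow> i < n \<Longrightarrow>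
      realization \<rho> (FP (FP (replicate h I) # replicate n Q)) x $ (h + i) =
      realization \<rho> Q (vec_of_list [x $ (h + 2 * i), x $ (h + 2 * i + 1)]) $ 0"
proof -
  have eq: "FP (FP (replicate h I) # replicate n Q) = FP2 (FP (replicate h I)) (FP (replicate n Q))"
    using pos by (intro FP_Cons) simp
  have Is: "is_nn h h (FP (replicate h I))" and Qs: "is_nn (2 * n) n (FP (replicate n Q))"
    using is_nn_FP_replicate[OF pos(1) I] is_nn_FP_replicate[OF pos(2) Q] by (simp_all add: mult.commute)
  have lens: "length (FP (replicate h I)) = length (FP (replicate n Q))"
    using pos len by (simp add: length_FP_replicate)
  show "is_nn (h + 2 * n) (h + n) (FP (FP (replicate h I) # replicate n Q))"
    unfolding eq by (rule is_nn_FP2[OF lens Is Qs])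
  show "length (FP (FP (replicate h I) # replicate n Q)) = length I"
    using pos len by (simp add: eq length_FP2 length_FP_replicate)
  {
    assume x: "x \<in> carrier_vec (h + 2 * n)"
    define y z where "y = vec_first x h" and "z = vec_last x (2 * n)"
    have xyz: "x = y @\<^sub>v z" and y: "y \<in> carrier_vec h" and z: "z \<in> carrier_vec (2 * n)"
      using x by (simp_all add: y_def z_def)
    have R: "realization \<rho> (FP (FP (replicate h I) # replicate n Q)) x =
        realization \<rho> (FP (replicate h I)) y @\<^sub>v realization \<rho> (FP (replicate n Q)) z"
      unfolding eq xyz by (rule realization_FP2[OF lens Is Qs y z])
    have d: "dim_vec (realization \<rho> (FP (replicate h I)) y) = h"
      "dim_vec (realization \<rho> (FP (replicate n Q)) z) = n"
      using realization_dim[OF Is y] realization_dim[OF Qs z] by auto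
    show "realization \<rho> (FP (FP (replicate h I) # replicate n Q)) x $ i
        = realization \<rho> I (vec_of_list [x $ i]) $ 0" if "i < h"
    proof -
      have "vec 1 (\<lambda>j. y $ (i * 1 + j)) = vec_of_list [x $ i]"
        using that y z by (intro eq_vecI) (auto simp: xyz vec_of_list_index simp del: vec_of_list_Cons)
      then show ?thesis
        using realization_FP_replicate[OF I, of y h i \<rho>] that y d by (simp add: R)
    qed
    show "realization \<rho> (FP (FP (replicate h I) # replicate n Q)) x $ (h + i)
        = realization \<rho> Q (vec_of_list [x $ (h + 2 * i), x $ (h + 2 * i + 1)]) $ 0" if "i < n"
    proof -
      have "vec 2 (\<lambda>j. z $ (i * 2 + j)) = vec_of_list [x $ (h + 2 * i), x $ (h + 2 * i + 1)]"
        using that y z by (intro eq_vecI)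
          (auto simp: xyz vec_of_list_index less_Suc_eq numeral_2_eq_2 mult.commute simp del: vec_of_list_Cons)
      then show ?thesis
        using realization_FP_replicate[OF Q, of z n i \<rho>] that z d by (simp add: R mult.commute)
    qed
  }
qed

section \<open>Entries and action of the two transition matrices\<close>

lemma mult_mat_vec_single:
  fixes A :: "real mat"
  assumes "A \<in> carrier_mat n d" and "v \<in> carrier_vec d" and "i < n" and "c < d"
    and "\<And>j. j < d \<Longrightarrow> A $$ (i, j) = (if j = c then 1 else 0)"
  shows "(A *\<^sub>v v) $ i = v $ c"
proof -
  have "(A *\<^sub>v v) $ i = (\<Sum>j<d. A $$ (i, j) * v $ j)"
    using assms by (simp add: scalar_prod_def atLeast0LessThan)
  also have "\<dots> = (\<Sum>j<d. if j = c then v $ j else 0)"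
    by (intro sum.cong) (auto simp: assms(5))
  finally show ?thesis using assms by simp
qed

text \<open>Evaluates the rounding in \<open>cheb_A1\<close> at the first row of an input pair; the
  next lemma treats the second row. In natural numbers this is the ceiling of q / 2.\<close>

lemma ceiling_double_quarter: "\<lceil>2 * real q / 4\<rceil> = int ((q + 1) div 2)"
proof (rule ceiling_unique)
  have "2 * ((q + 1) div 2) \<le> q + 1" "q \<le> 2 * ((q + 1) div 2)" by linarith+
  then have "2 * real ((q + 1) div 2) \<le> real q + 1" "real q \<le> 2 * real ((q + 1) div 2)" by linarith+
  then show "real_of_int (int ((q + 1) div 2)) - 1 < 2 * real q / 4"
    "2 * real q / 4 \<le> real_of_int (int ((q + 1) div 2))"
    by simp_all
qed

lemma ceiling_double_plus_1_quarter: "\<lceil>(2 * real q + 1) / 4\<rceil> = int ((q + 2) div 2)"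
proof (rule ceiling_unique)
  have "2 * ((q + 2) div 2) \<le> q + 2" "q + 1 \<le> 2 * ((q + 2) div 2)" by linarith+
  then have "2 * real ((q + 2) div 2) \<le> real q + 2" "real q + 1 \<le> 2 * real ((q + 2) div 2)" by linarith+
  then show "real_of_int (int ((q + 2) div 2)) - 1 < (2 * real q + 1) / 4"
    "(2 * real q + 1) / 4 \<le> real_of_int (int ((q + 2) div 2))"
    by simp_all
qed

lemma cheb_A1_carrier: "mtilde m = 2 * h \<Longrightarrow> cheb_A1 m \<in> carrier_mat (2 * m - h) h"
  by (simp add: cheb_A1_def Let_def)

text \<open>Each row selects a single entry. Rows \<open>h + 2 * q\<close> and
  \<open>h + 2 * q + 1\<close> feed the product for degree j = h + q + 1 and select the degrees j
  div 2 and (j + 1) div 2; the \<open>- 1\<close> converts a degree to an index from 0. Evenness of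
  \<open>h\<close> makes \<open>mtilde m / 4\<close> the integer \<open>g\<close>.\<close>

lemma cheb_A1_index:
  assumes "mtilde m = 2 * h" and "h = 2 * g" and "0 < g" and "h < m" and "j < h"
  shows "i < h \<Longrightarrow> cheb_A1 m $$ (i, j) = (if j = i then 1 else 0)"
    and "q < m - h \<Longrightarrow> cheb_A1 m $$ (h + 2 * q, j) = (if j = (h + q + 1) div 2 - 1 then 1 else 0)"
    and "q < m - h \<Longrightarrow> cheb_A1 m $$ (h + 2 * q + 1, j) = (if j = (h + q + 2) div 2 - 1 then 1 else 0)"
proof -
  have g: "real (mtilde m) / 4 = real g" using assms by simp
  show "cheb_A1 m $$ (i, j) = (if j = i then 1 else 0)" if "i < h"
    using assms that by (simp add: cheb_A1_def Let_def)
  show "cheb_A1 m $$ (h + 2 * q, j) = (if j = (h + q + 1) div 2 - 1 then 1 else 0)" if "q < m - h"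
  proof -
    have "(real (h + 2 * q + 1) - 1 - real h) / 4 = 2 * real q / 4" by simp
    then have "real (j + 1) = real (mtilde m) / 4 + of_int \<lceil>(real (h + 2 * q + 1) - 1 - real h) / 4\<rceil>
        \<longleftrightarrow> real (j + 1) = real (g + (q + 1) div 2)"
      unfolding g by (simp only: ceiling_double_quarter) simp
    also have "\<dots> \<longleftrightarrow> j + 1 = g + (q + 1) div 2" by (rule of_nat_eq_iff)
    also have "\<dots> \<longleftrightarrow> j = (h + q + 1) div 2 - 1" using assms by auto
    finally show ?thesis
      using assms that by (simp add: cheb_A1_def Let_def)
  qed
  show "cheb_A1 m $$ (h + 2 * q + 1, j) = (if j = (h + q + 2) div 2 - 1 then 1 else 0)" if "q < m - h"
  proof -
    have "(real (h + 2 * q + 1 + 1) - 1 - real h) / 4 = (2 * real q + 1) / 4" by simp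
    then have "real (j + 1) = real (mtilde m) / 4 + of_int \<lceil>(real (h + 2 * q + 1 + 1) - 1 - real h) / 4\<rceil>
        \<longleftrightarrow> real (j + 1) = real (g + (q + 2) div 2)"
      unfolding g by (simp only: ceiling_double_plus_1_quarter) simp
    also have "\<dots> \<longleftrightarrow> j + 1 = g + (q + 2) div 2" by (rule of_nat_eq_iff)
    also have "\<dots> \<longleftrightarrow> j = (h + q + 2) div 2 - 1" using assms by auto
    finally show ?thesis
      using assms that by (simp add: cheb_A1_def Let_def)
  qed
qed

lemma cheb_A2_carrier: "cheb_A2 m \<in> carrier_mat m m"
  by (simp add: cheb_A2_def Let_def)

lemma cheb_b2_carrier: "cheb_b2 m \<in> carrier_vec m"
  by (simp add: cheb_b2_def Let_def)

text \<open>A row has its diagonal entry and possibly a correction in column 0, so the sum over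
  columns splits into two single-term sums. Index \<open>i\<close> stands for degree i + 1: an even
  degree subtracts T_0 = 1 through the bias, an odd degree subtracts the copy of T_1 held in
  \<open>z $ 0\<close>.\<close>

lemma cheb_A2_mult:
  assumes "mtilde m = 2 * h" and "0 < h" and "i < m" and z: "z \<in> carrier_vec m"
  shows "(cheb_A2 m *\<^sub>v z + cheb_b2 m) $ i =
    (if i < h then z $ i else 2 * z $ i - (if even (i + 1) then 1 else z $ 0))"
proof -
  have "(cheb_A2 m *\<^sub>v z + cheb_b2 m) $ i = (\<Sum>j<m. cheb_A2 m $$ (i, j) * z $ j) + cheb_b2 m $ i"
    using assms cheb_A2_carrier[of m] cheb_b2_carrier[of m]
    by (simp add: scalar_prod_def atLeast0LessThan)
  also have "(\<Sum>j<m. cheb_A2 m $$ (i, j) * z $ j) =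
      (\<Sum>j<m. if j = i then (if i < h then 1 else 2) * z $ j else 0) +
      (\<Sum>j<m. if j = 0 then (if h \<le> i \<and> odd (i + 1) then - z $ j else 0) else 0)"
    unfolding sum.distrib[symmetric]
    using assms by (intro sum.cong) (auto simp: cheb_A2_def Let_def)
  finally show ?thesis
    using assms by (simp add: cheb_b2_def Let_def)
qed

text \<open>One level for arbitrary blocks and an arbitrary previous network \<open>N\<close>: only
  dimensions and wiring matter here. Since index \<open>i\<close> carries degree i + 1, the factors
  have degrees (i + 1) div 2 and (i + 2) div 2.\<close>

lemma cheb_step:
  fixes I Q N :: nn
  assumes I: "is_nn 1 1 I" "length I = 2" and Q: "is_nn 2 1 Q" "length Q = 2"
    and N: "is_nn d h N" and h: "mtilde m = 2 * h" "even h" "0 < h" "h < m" "m \<le> 2 * h"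
  defines "N' \<equiv> [(cheb_A2 m, cheb_b2 m)] \<bullet>\<^sub>N FP (FP (replicate h I) # replicate (m - h) Q)
      \<bullet>\<^sub>N [(cheb_A1 m, cheb_b1 m)] \<bullet>\<^sub>N N"
  shows is_nn_cheb_step: "is_nn d m N'"
    and length_cheb_step: "length N' = length N + 1"
    and realization_cheb_step_id: "x \<in> carrier_vec d \<Longrightarrow> i < h \<Longrightarrow>
      realization \<rho> N' x $ i = realization \<rho> I (vec_of_list [realization \<rho> N x $ i]) $ 0"
    and realization_cheb_step_prod: "x \<in> carrier_vec d \<Longrightarrow> h \<le> i \<Longrightarrow> i < m \<Longrightarrow>
      realization \<rho> N' x $ i =
        2 * realization \<rho> Q (vec_of_list [realization \<rho> N x $ ((i + 1) div 2 - 1),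
          realization \<rho> N x $ ((i + 2) div 2 - 1)]) $ 0
        - (if even (i + 1) then 1 else realization \<rho> I (vec_of_list [realization \<rho> N x $ 0]) $ 0)"
proof -
  obtain g where g: "h = 2 * g" "0 < g" using h by auto
  define P where "P = FP (FP (replicate h I) # replicate (m - h) Q)"
  define L where "L = [(cheb_A1 m, cheb_b1 m)] \<bullet>\<^sub>N N"
  define n where "n = m - h"
  \<comment> \<open>Each of the \<open>n\<close> products has two inputs and one output, so the
    widths around the blocks are h + 2 n and h + n.\<close>
  have n: "0 < n" "2 * m - h = h + 2 * n" "m = h + n" using h by (auto simp: n_def)
  have N': "N' = [(cheb_A2 m, cheb_b2 m)] \<bullet>\<^sub>N P \<bullet>\<^sub>N L" by (simp add: N'_def P_def L_def)
  have A1: "is_nn h (h + 2 * n) [(cheb_A1 m, cheb_b1 m)]"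
    using h n cheb_A1_carrier[OF h(1)] by (simp add: cheb_b1_def)
  have A2: "is_nn m m [(cheb_A2 m, cheb_b2 m)]"
    using h by (simp add: cheb_A2_carrier cheb_b2_carrier)
  have len: "length I = length Q" using I Q by simp
  note P_facts = FP_id_prod[OF I(1) Q(1) len h(3) n(1), folded n(3), folded n_def]
  have P: "is_nn (h + 2 * n) m P" "length P = 2"
    using P_facts(1,2) I by (simp_all add: P_def n_def)
  have L: "is_nn d (h + 2 * n) L" unfolding L_def by (rule is_nn_concat[OF N A1])
  have PL: "is_nn d m (P \<bullet>\<^sub>N L)" by (rule is_nn_concat[OF L P(1)])
  show "is_nn d m N'" unfolding N' by (rule is_nn_concat[OF PL A2])
  have "N \<noteq> []" "P \<noteq> []" using is_nn_nonempty[OF N] P(2) by auto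
  then have "length L = length N" "length (P \<bullet>\<^sub>N L) = length N + 1" "length N' = length N + 1"
    using length_nn_concat[of "[(cheb_A1 m, cheb_b1 m)]" N] length_nn_concat[of P L]
      length_nn_concat[of "[(cheb_A2 m, cheb_b2 m)]" "P \<bullet>\<^sub>N L"] P(2)
    by (auto simp: N' L_def nn_concat_nonempty)
  then show "length N' = length N + 1" by simp
  {
    assume x: "x \<in> carrier_vec d"
    define y where "y = realization \<rho> N x"
    define w where "w = realization \<rho> L x"
    define z where "z = realization \<rho> P w"
    have y: "y \<in> carrier_vec h" unfolding y_def by (rule realization_dim[OF N x])
    have w: "w \<in> carrier_vec (h + 2 * n)" unfolding w_def by (rule realization_dim[OF L x])
    have z: "z \<in> carrier_vec m" unfolding z_def by (rule realization_dim[OF P(1) w])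
    have w_eq: "w = cheb_A1 m *\<^sub>v y"
      unfolding w_def L_def realization_concat[OF N A1 x] y_def[symmetric]
      using mult_mat_vec_carrier[OF cheb_A1_carrier[OF h(1)] y] by (simp add: cheb_b1_def h(1))
    have "realization \<rho> N' x = cheb_A2 m *\<^sub>v z + cheb_b2 m"
      unfolding N' realization_concat[OF PL A2 x] realization_concat[OF L P(1) x]
      by (simp add: z_def w_def)
    then have R: "realization \<rho> N' x $ i =
        (if i < h then z $ i else 2 * z $ i - (if even (i + 1) then 1 else z $ 0))" if "i < m" for i
      using cheb_A2_mult[OF h(1,3) that z] by simp
    have w_id: "w $ i = y $ i" if "i < h" for i
      unfolding w_eq
      by (rule mult_mat_vec_single[OF cheb_A1_carrier[OF h(1)] y])
        (use that h n cheb_A1_index(1)[OF h(1) g h(4)] in auto)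
    have z_id: "z $ i = realization \<rho> I (vec_of_list [y $ i]) $ 0" if "i < h" for i
      using P_facts(3)[OF _ that, of w \<rho>] w w_id[OF that] by (simp add: z_def P_def n_def)
    have w_prod: "w $ (h + 2 * q) = y $ ((h + q + 1) div 2 - 1)"
      "w $ (h + 2 * q + 1) = y $ ((h + q + 2) div 2 - 1)" if q: "q < n" for q
    proof -
      \<comment> \<open>The selected degrees exist on the previous level because q < n \<le> h; this
        is where \<open>m \<le> 2 * h\<close> enters.\<close>
      have lt: "h + 2 * q < 2 * m - h" "h + 2 * q + 1 < 2 * m - h"
        "(h + q + 1) div 2 - 1 < h" "(h + q + 2) div 2 - 1 < h"
        using q n h by linarith+
      have q': "q < m - h" using q by (simp add: n_def)
      show "w $ (h + 2 * q) = y $ ((h + q + 1) div 2 - 1)" unfolding w_eq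
        by (rule mult_mat_vec_single[OF cheb_A1_carrier[OF h(1)] y lt(1,3)])
          (rule cheb_A1_index(2)[OF h(1) g h(4) _ q'])
      show "w $ (h + 2 * q + 1) = y $ ((h + q + 2) div 2 - 1)" unfolding w_eq
        by (rule mult_mat_vec_single[OF cheb_A1_carrier[OF h(1)] y lt(2,4)])
          (rule cheb_A1_index(3)[OF h(1) g h(4) _ q'])
    qed
    have z_prod: "z $ (h + q) = realization \<rho> Q
        (vec_of_list [y $ ((h + q + 1) div 2 - 1), y $ ((h + q + 2) div 2 - 1)]) $ 0" if "q < n" for q
      using P_facts(4)[OF _ that, of w \<rho>] w w_prod[OF that] by (simp add: z_def P_def n_def)
    show "realization \<rho> N' x $ i = realization \<rho> I (vec_of_list [realization \<rho> N x $ i]) $ 0"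
      if "i < h"
      using R[of i] that h z_id[OF that] by (simp add: y_def)
    show "realization \<rho> N' x $ i =
        2 * realization \<rho> Q (vec_of_list [realization \<rho> N x $ ((i + 1) div 2 - 1),
          realization \<rho> N x $ ((i + 2) div 2 - 1)]) $ 0
        - (if even (i + 1) then 1 else realization \<rho> I (vec_of_list [realization \<rho> N x $ 0]) $ 0)"
      if "h \<le> i" "i < m"
      using R[of i] that z_id[OF h(3)] z_prod[of "i - h"] n by (simp add: y_def)
  }
qed

subsection \<open>Counting nonzero weights\<close>

definition row_nnz :: "real mat \<Rightarrow> nat \<Rightarrow> nat" where
  "row_nnz A i = card {j. j < dim_col A \<and> A $$ (i, j) \<noteq> 0}"

text \<open>Sparsity is measured by rows because that is what matrix products respect: if every row
  of B has at most K nonzero entries, A B has at most K times as many as A.\<close>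

definition rows_le :: "nat \<Rightarrow> real mat \<Rightarrow> bool" where
  "rows_le K A \<longleftrightarrow> (\<forall>i<dim_row A. row_nnz A i \<le> K)"

lemma nnz_mat_eq_sum: "nnz_mat A = (\<Sum>i<dim_row A. row_nnz A i)"
proof -
  have "{(i, j). i < dim_row A \<and> j < dim_col A \<and> A $$ (i, j) \<noteq> 0} =
      Sigma {..<dim_row A} (\<lambda>i. {j. j < dim_col A \<and> A $$ (i, j) \<noteq> 0})"
    by auto
  then show ?thesis by (simp add: nnz_mat_def row_nnz_def)
qed

lemma row_nnz_le_nnz_mat: "i < dim_row A \<Longrightarrow> row_nnz A i \<le> nnz_mat A"
  unfolding nnz_mat_eq_sum by (rule member_le_sum) auto

lemma row_nnz_le_dim_col: "row_nnz A i \<le> dim_col A"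
proof -
  have "row_nnz A i \<le> card {..<dim_col A}" unfolding row_nnz_def by (intro card_mono) auto
  then show ?thesis by simp
qed

lemma nnz_mat_le: "rows_le K A \<Longrightarrow> nnz_mat A \<le> dim_row A * K"
  unfolding nnz_mat_eq_sum rows_le_def using sum_bounded_above[of "{..<dim_row A}" "row_nnz A" K] by simp

lemma nnz_vec_le_dim: "nnz_vec b \<le> dim_vec b"
proof -
  have "nnz_vec b \<le> card {..<dim_vec b}" unfolding nnz_vec_def by (intro card_mono) auto
  then show ?thesis by simp
qed

text \<open>Row i of A B is a combination of the rows of B picked out by the nonzero entries of row
  i of A, so its support lies in the union of theirs.\<close>

lemma row_nnz_mult_le:
  assumes "rows_le K B" and "dim_col A = dim_row B" and "i < dim_row A"
  shows "row_nnz (A * B) i \<le> row_nnz A i * K"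
proof -
  let ?I = "{k. k < dim_col A \<and> A $$ (i, k) \<noteq> 0}"
  let ?J = "\<lambda>k. {j. j < dim_col B \<and> B $$ (k, j) \<noteq> 0}"
  have "{j. j < dim_col (A * B) \<and> (A * B) $$ (i, j) \<noteq> 0} \<subseteq> (\<Union>k\<in>?I. ?J k)"
  proof
    fix j assume j: "j \<in> {j. j < dim_col (A * B) \<and> (A * B) $$ (i, j) \<noteq> 0}"
    then have "j < dim_col B" "(A * B) $$ (i, j) \<noteq> 0" by auto
    then have "(\<Sum>k = 0..<dim_row B. A $$ (i, k) * B $$ (k, j)) \<noteq> 0"
      using assms by (simp add: scalar_prod_def)
    then obtain k where "k < dim_row B" "A $$ (i, k) * B $$ (k, j) \<noteq> 0"
      by (meson sum.not_neutral_contains_not_neutral atLeastLessThan_iff)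
    then show "j \<in> (\<Union>k\<in>?I. ?J k)" using j assms by auto
  qed
  then have "row_nnz (A * B) i \<le> card (\<Union>k\<in>?I. ?J k)"
    unfolding row_nnz_def by (intro card_mono) auto
  also have "\<dots> \<le> (\<Sum>k\<in>?I. card (?J k))" by (intro card_UN_le) auto
  also have "\<dots> \<le> of_nat (card ?I) * K"
    using assms by (intro sum_bounded_above) (auto simp: rows_le_def row_nnz_def)
  finally show ?thesis by (simp add: row_nnz_def)
qed

lemma nnz_mat_mult_le:
  assumes "rows_le K B" and "dim_col A = dim_row B"
  shows "nnz_mat (A * B) \<le> nnz_mat A * K"
  unfolding nnz_mat_eq_sum sum_distrib_right using assms by (auto intro!: sum_mono row_nnz_mult_le)

lemma rows_le_mult:
  assumes "rows_le r A" and "rows_le K B" and "dim_col A = dim_row B"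
  shows "rows_le (r * K) (A * B)"
  unfolding rows_le_def
proof (intro allI impI)
  fix i assume i: "i < dim_row (A * B)"
  then have "row_nnz (A * B) i \<le> row_nnz A i * K" using assms by (intro row_nnz_mult_le) auto
  also have "\<dots> \<le> r * K" using assms i by (intro mult_right_mono) (auto simp: rows_le_def)
  finally show "row_nnz (A * B) i \<le> r * K" .
qed

text \<open>A nonzero entry needs a nonzero row of A or a nonzero entry of c. The bound ignores
  \<open>b\<close>, so a dense bias of the previous network does no harm.\<close>

lemma nnz_vec_affine_le:
  assumes "dim_vec c = dim_row A" and "dim_vec b = dim_col A"
  shows "nnz_vec (A *\<^sub>v b + c) \<le> nnz_mat A + nnz_vec c"
proof -
  let ?I = "{i. i < dim_row A \<and> row_nnz A i \<noteq> 0}"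
  have "{i. i < dim_vec (A *\<^sub>v b + c) \<and> (A *\<^sub>v b + c) $ i \<noteq> 0} \<subseteq> ?I \<union> {i. i < dim_vec c \<and> c $ i \<noteq> 0}"
  proof
    fix i assume i: "i \<in> {i. i < dim_vec (A *\<^sub>v b + c) \<and> (A *\<^sub>v b + c) $ i \<noteq> 0}"
    show "i \<in> ?I \<union> {i. i < dim_vec c \<and> c $ i \<noteq> 0}"
    proof (cases "c $ i = 0")
      case True
      have "i < dim_row A" "(A *\<^sub>v b + c) $ i \<noteq> 0" using i assms by auto
      with True assms have "(\<Sum>j = 0..<dim_col A. A $$ (i, j) * b $ j) \<noteq> 0"
        by (simp add: scalar_prod_def)
      then obtain j where "j < dim_col A" "A $$ (i, j) * b $ j \<noteq> 0"
        by (meson sum.not_neutral_contains_not_neutral atLeastLessThan_iff)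
      then have "{j. j < dim_col A \<and> A $$ (i, j) \<noteq> 0} \<noteq> {}" by auto
      then have "row_nnz A i \<noteq> 0" by (simp add: row_nnz_def card_eq_0_iff)
      with i assms show ?thesis by simp
    qed (use i assms in auto)
  qed
  then have "nnz_vec (A *\<^sub>v b + c) \<le> card (?I \<union> {i. i < dim_vec c \<and> c $ i \<noteq> 0})"
    unfolding nnz_vec_def by (intro card_mono) auto
  also have "\<dots> \<le> card ?I + nnz_vec c" unfolding nnz_vec_def by (rule card_Un_le)
  also have "card ?I = (\<Sum>i\<in>?I. 1)" by simp
  also have "\<dots> \<le> (\<Sum>i\<in>?I. row_nnz A i)" by (intro sum_mono) auto
  also have "\<dots> \<le> nnz_mat A" unfolding nnz_mat_eq_sum by (intro sum_mono2) auto
  finally show ?thesis by simp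
qed

lemma row_nnz_four_block_diag:
  assumes "i < dim_row A + dim_row B"
  shows "row_nnz (four_block_mat A (0\<^sub>m (dim_row A) (dim_col B)) (0\<^sub>m (dim_row B) (dim_col A)) B) i =
    (if i < dim_row A then row_nnz A i else row_nnz B (i - dim_row A))"
proof (cases "i < dim_row A")
  case True
  then show ?thesis unfolding row_nnz_def
    by (auto intro!: arg_cong[of _ _ card] split: if_splits)
next
  case False
  let ?M = "four_block_mat A (0\<^sub>m (dim_row A) (dim_col B)) (0\<^sub>m (dim_row B) (dim_col A)) B"
  have "{j. j < dim_col ?M \<and> ?M $$ (i, j) \<noteq> 0} =
      (+) (dim_col A) ` {j. j < dim_col B \<and> B $$ (i - dim_row A, j) \<noteq> 0}"
  proof (intro equalityI subsetI)
    fix j assume "j \<in> {j. j < dim_col ?M \<and> ?M $$ (i, j) \<noteq> 0}"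
    then show "j \<in> (+) (dim_col A) ` {j. j < dim_col B \<and> B $$ (i - dim_row A, j) \<noteq> 0}"
      using False assms by (intro image_eqI[of _ _ "j - dim_col A"]) (auto split: if_splits)
  qed (use False assms in auto)
  then show ?thesis using False unfolding row_nnz_def by (simp add: card_image)
qed

lemma nnz_mat_four_block_diag:
  "nnz_mat (four_block_mat A (0\<^sub>m (dim_row A) (dim_col B)) (0\<^sub>m (dim_row B) (dim_col A)) B) =
    nnz_mat A + nnz_mat B"
proof -
  have sum_add: "(\<Sum>i<a + b. f i) = (\<Sum>i<a. f i) + (\<Sum>i<b. f (a + i))" for a b and f :: "nat \<Rightarrow> nat"
    by (induction b) auto
  show ?thesis
    unfolding nnz_mat_eq_sum using row_nnz_four_block_diag[of _ A B]
    by (simp add: sum_add)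
qed

lemma nnz_vec_append_le: "nnz_vec (a @\<^sub>v b) \<le> nnz_vec a + nnz_vec b"
proof -
  let ?A = "{i. i < dim_vec a \<and> a $ i \<noteq> 0}" and ?B = "{i. i < dim_vec b \<and> b $ i \<noteq> 0}"
  have "{i. i < dim_vec (a @\<^sub>v b) \<and> (a @\<^sub>v b) $ i \<noteq> 0} \<subseteq> ?A \<union> (+) (dim_vec a) ` ?B"
  proof
    fix i assume i: "i \<in> {i. i < dim_vec (a @\<^sub>v b) \<and> (a @\<^sub>v b) $ i \<noteq> 0}"
    show "i \<in> ?A \<union> (+) (dim_vec a) ` ?B"
    proof (cases "i < dim_vec a")
      case False
      with i have "i \<in> (+) (dim_vec a) ` ?B"
        by (intro image_eqI[of _ _ "i - dim_vec a"]) auto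
      then show ?thesis by simp
    qed (use i in auto)
  qed
  then have "nnz_vec (a @\<^sub>v b) \<le> card (?A \<union> (+) (dim_vec a) ` ?B)"
    unfolding nnz_vec_def by (intro card_mono) auto
  also have "\<dots> \<le> card ?A + card ((+) (dim_vec a) ` ?B)" by (rule card_Un_le)
  also have "card ((+) (dim_vec a) ` ?B) \<le> card ?B" by (intro card_image_le) auto
  finally show ?thesis by (simp add: nnz_vec_def)
qed

section \<open>Network sizes under parallelization and concatenation\<close>

lemma nn_size_Nil: "nn_size [] = 0"
  by (simp add: nn_size_def)

lemma nn_size_Cons: "nn_size ((A, b) # \<Phi>) = nnz_mat A + nnz_vec b + nn_size \<Phi>"
  by (simp add: nn_size_def)

lemma nn_size_append: "nn_size (\<Phi> @ \<Psi>) = nn_size \<Phi> + nn_size \<Psi>"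
  by (simp add: nn_size_def)

lemma nn_size_FP2_le: "length \<Phi> = length \<Psi> \<Longrightarrow> nn_size (FP2 \<Phi> \<Psi>) \<le> nn_size \<Phi> + nn_size \<Psi>"
proof (induction \<Phi> \<Psi> rule: list_induct2)
  case (Cons x \<Phi> y \<Psi>)
  obtain A b A' b' where [simp]: "x = (A, b)" "y = (A', b')" by (cases x; cases y) auto
  show ?case
    using Cons nnz_vec_append_le[of b b'] by (simp add: FP2_Cons nn_size_Cons nnz_mat_four_block_diag)
qed (simp add: FP2_def)

lemma nn_size_FP_replicate_le: "0 < n \<Longrightarrow> nn_size (FP (replicate n \<Phi>)) \<le> n * nn_size \<Phi>"
proof (induction n)
  case (Suc n)
  show ?case
  proof (cases "n = 0")
    case False
    then have "nn_size (FP2 \<Phi> (FP (replicate n \<Phi>))) \<le> nn_size \<Phi> + nn_size (FP (replicate n \<Phi>))"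
      by (intro nn_size_FP2_le) (simp add: length_FP_replicate)
    with Suc False show ?thesis by (simp add: FP_Cons)
  qed simp
qed simp

text \<open>A row cannot have more nonzero entries than the whole network. The crude bound suffices
  because it is applied to single blocks, whose size is bounded.\<close>

lemma rows_le_last:
  assumes "\<Phi> \<noteq> []" and "nn_size \<Phi> \<le> K"
  shows "rows_le K (fst (last \<Phi>))"
proof -
  obtain A b where L: "last \<Phi> = (A, b)" by (cases "last \<Phi>")
  have "nn_size \<Phi> = nn_size (butlast \<Phi>) + nn_size [(A, b)]"
    using assms(1) by (metis L append_butlast_last_id nn_size_append)
  with assms(2) have "nnz_mat A \<le> K" by (simp add: nn_size_Cons)
  then show ?thesis unfolding rows_le_def L by (simp, meson row_nnz_le_nnz_mat order_trans)
qed

text \<open>A row of a block diagonal matrix meets only one block, so row counts do not add up,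
  unlike sizes.\<close>

lemma rows_le_last_FP2:
  assumes "length \<Phi> = length \<Psi>" and "\<Phi> \<noteq> []"
    and "rows_le K (fst (last \<Phi>))" and "rows_le K (fst (last \<Psi>))"
  shows "rows_le K (fst (last (FP2 \<Phi> \<Psi>)))"
proof -
  obtain A b A' b' where L: "last \<Phi> = (A, b)" "last \<Psi> = (A', b')" by (cases "last \<Phi>"; cases "last \<Psi>") auto
  have "\<Psi> \<noteq> []" using assms by auto
  with assms have "last (FP2 \<Phi> \<Psi>) = par_layer (A, b) (A', b')"
    by (simp add: FP2_def last_map last_zip L)
  with assms(3,4) show ?thesis
    by (auto simp: L rows_le_def row_nnz_four_block_diag)
qed

lemma rows_le_last_FP_replicate:
  "0 < n \<Longrightarrow> \<Phi> \<noteq> [] \<Longrightarrow> rows_le K (fst (last \<Phi>)) \<Longrightarrow> rows_le K (fst (last (FP (replicate n \<Phi>))))"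
proof (induction n)
  case (Suc n)
  then show ?case
    by (cases "n = 0") (auto simp: FP_Cons length_FP_replicate intro!: rows_le_last_FP2)
qed simp

lemma is_nn_last:
  "is_nn d n \<Phi> \<Longrightarrow> last \<Phi> = (A, b) \<Longrightarrow> dim_row A = n \<and> dim_vec b = n"
  by (induction d n \<Phi> rule: is_nn.induct) auto

text \<open>Two layers are new. The four summands bound the weights and bias of the first
  (\<open>S * R\<close>, \<open>S\<close>) and of the last (\<open>p * r * K\<close>,
  \<open>p\<close>). The row bound of the result is independent of \<open>R\<close>, which stops
  growth along the recursion.\<close>

lemma nn_size_affine_concat_le:
  assumes L: "is_nn d n L" and RL: "rows_le R (fst (last L))"
    and P: "is_nn n m P" "length P = 2" "nn_size P \<le> S" and K: "rows_le K (fst (last P))"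
    and A: "A \<in> carrier_mat p m" "rows_le r A" and b: "b \<in> carrier_vec p"
  shows "nn_size ([(A, b)] \<bullet>\<^sub>N P \<bullet>\<^sub>N L) \<le> nn_size (butlast L) + (S * R + S + p * r * K + p)"
    and "rows_le (r * K) (fst (last ([(A, b)] \<bullet>\<^sub>N P \<bullet>\<^sub>N L)))"
proof -
  obtain P1 p1 P2 p2 where P_eq: "P = [(P1, p1), (P2, p2)]"
    and Pc: "P1 \<in> carrier_mat (dim_vec p1) n" "P2 \<in> carrier_mat m (dim_vec p1)" "p2 \<in> carrier_vec m"
    using is_nn_length_2D[OF P(1,2)] .
  obtain A0 b0 where L0: "last L = (A0, b0)" by (cases "last L")
  have d0: "dim_row A0 = n" "dim_vec b0 = n" using is_nn_last[OF L L0] by auto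
  have eq: "[(A, b)] \<bullet>\<^sub>N P \<bullet>\<^sub>N L = butlast L @ [(P1 * A0, P1 *\<^sub>v b0 + p1), (A * P2, A *\<^sub>v p2 + b)]"
    by (simp add: nn_concat_def P_eq L0 butlast_append)
  have S: "nnz_mat P1 + nnz_vec p1 \<le> S" using P(3) by (simp add: P_eq nn_size_Cons)
  have "nnz_mat (P1 * A0) \<le> nnz_mat P1 * R"
    using RL Pc d0 by (intro nnz_mat_mult_le) (auto simp: L0)
  also have "\<dots> \<le> S * R" using S by (intro mult_right_mono) auto
  finally have 1: "nnz_mat (P1 * A0) \<le> S * R" .
  have 2: "nnz_vec (P1 *\<^sub>v b0 + p1) \<le> S"
    using nnz_vec_affine_le[of p1 P1 b0] Pc d0 S by simp
  have K2: "rows_le K P2" using K by (simp add: P_eq)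
  have "nnz_mat (A * P2) \<le> nnz_mat A * K" using K2 A Pc by (intro nnz_mat_mult_le) auto
  also have "\<dots> \<le> p * r * K" using nnz_mat_le[OF A(2)] A(1) by (intro mult_right_mono) auto
  finally have 3: "nnz_mat (A * P2) \<le> p * r * K" .
  have 4: "nnz_vec (A *\<^sub>v p2 + b) \<le> p" using nnz_vec_le_dim[of "A *\<^sub>v p2 + b"] b by simp
  show "nn_size ([(A, b)] \<bullet>\<^sub>N P \<bullet>\<^sub>N L) \<le> nn_size (butlast L) + (S * R + S + p * r * K + p)"
    using 1 2 3 4 by (simp add: eq nn_size_append nn_size_Cons nn_size_Nil)
  show "rows_le (r * K) (fst (last ([(A, b)] \<bullet>\<^sub>N P \<bullet>\<^sub>N L)))"
    using rows_le_mult[OF A(2) K2] A(1) Pc by (simp add: eq)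
qed

text \<open>Each of the two conditions on the entry determines the column from the row, and they
  exclude each other through i \<le> h and i > h.\<close>

lemma rows_le_cheb_A1: "rows_le 1 (cheb_A1 m)"
proof -
  have "card {j. j < dim_col (cheb_A1 m) \<and> cheb_A1 m $$ (i, j) \<noteq> 0} \<le> Suc 0"
    if "i < dim_row (cheb_A1 m)" for i
  proof (subst card_le_Suc0_iff_eq)
    show "\<forall>j\<in>{j. j < dim_col (cheb_A1 m) \<and> cheb_A1 m $$ (i, j) \<noteq> 0}.
        \<forall>j'\<in>{j. j < dim_col (cheb_A1 m) \<and> cheb_A1 m $$ (i, j) \<noteq> 0}. j = j'"
      using that by (auto simp: cheb_A1_def Let_def split: if_splits)
  qed simp
  then show ?thesis by (simp add: rows_le_def row_nnz_def)
qed

lemma rows_le_cheb_A2: "rows_le 2 (cheb_A2 m)"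
  unfolding rows_le_def
proof (intro allI impI)
  fix i assume "i < dim_row (cheb_A2 m)"
  then have "{j. j < dim_col (cheb_A2 m) \<and> cheb_A2 m $$ (i, j) \<noteq> 0} \<subseteq> {i, 0}"
    by (auto simp: cheb_A2_def Let_def split: if_splits)
  then have "row_nnz (cheb_A2 m) i \<le> card {i, 0}" unfolding row_nnz_def by (intro card_mono) auto
  also have "\<dots> \<le> 2" by (simp add: card_insert_if)
  finally show "row_nnz (cheb_A2 m) i \<le> 2" .
qed


subsection \<open>The Chebyshev networks\<close>

text \<open>The factor arises from S = m K, R = 2 K, p = m and r = 2: m K * 2 K + m K + 2 m K + m.
  The row bound \<open>2 * K\<close> is reproduced, so the lemma can be iterated with a fixed
  constant.\<close>

lemma nn_size_cheb_step:
  assumes I: "is_nn 1 1 I" "length I = 2" "nn_size I \<le> K"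
    and Q: "is_nn 2 1 Q" "length Q = 2" "nn_size Q \<le> K"
    and N: "is_nn d h N" "rows_le (2 * K) (fst (last N))" and h: "mtilde m = 2 * h" "0 < h" "h < m"
  defines "N' \<equiv> [(cheb_A2 m, cheb_b2 m)] \<bullet>\<^sub>N FP (FP (replicate h I) # replicate (m - h) Q)
      \<bullet>\<^sub>N [(cheb_A1 m, cheb_b1 m)] \<bullet>\<^sub>N N"
  shows "nn_size N' \<le> nn_size N + (2 * K\<^sup>2 + 3 * K + 1) * m"
    and "rows_le (2 * K) (fst (last N'))"
proof -
  define P where "P = FP (FP (replicate h I) # replicate (m - h) Q)"
  define L where "L = [(cheb_A1 m, cheb_b1 m)] \<bullet>\<^sub>N N"
  have N': "N' = [(cheb_A2 m, cheb_b2 m)] \<bullet>\<^sub>N P \<bullet>\<^sub>N L" by (simp add: N'_def P_def L_def)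
  have pos: "0 < m - h" using h by simp
  have len: "length I = length Q" using I Q by simp
  have P: "is_nn (2 * m - h) m P" "length P = 2"
    using is_nn_FP_id_prod[OF I(1) Q(1) len h(2) pos] length_FP_id_prod[OF I(1) Q(1) len h(2) pos] I h
    by (simp_all add: P_def diff_mult_distrib2)
  have P_eq: "P = FP2 (FP (replicate h I)) (FP (replicate (m - h) Q))"
    unfolding P_def using pos by (intro FP_Cons) simp
  have lens: "length (FP (replicate h I)) = 2" "length (FP (replicate (m - h) Q)) = 2"
    using h pos I Q by (simp_all add: length_FP_replicate)
  have "nn_size P \<le> h * nn_size I + (m - h) * nn_size Q"
    unfolding P_eq using lens h pos
    by (intro order_trans[OF nn_size_FP2_le] add_mono nn_size_FP_replicate_le) simp_all
  also have "\<dots> \<le> h * K + (m - h) * K" using I Q by (intro add_mono mult_left_mono) auto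
  also have "\<dots> = m * K" using h by (simp add: add_mult_distrib[symmetric])
  finally have S: "nn_size P \<le> m * K" .
  have "I \<noteq> []" "Q \<noteq> []" using I Q by auto
  then have K: "rows_le K (fst (last P))"
    unfolding P_eq using lens h pos I Q
    by (intro rows_le_last_FP2 rows_le_last_FP_replicate rows_le_last) auto
  have A1: "is_nn h (2 * m - h) [(cheb_A1 m, cheb_b1 m)]"
    using h cheb_A1_carrier[OF h(1)] by (simp add: cheb_b1_def)
  have L: "is_nn d (2 * m - h) L" unfolding L_def by (rule is_nn_concat[OF N(1) A1])
  have Lb: "butlast L = butlast N" "fst (last L) = cheb_A1 m * fst (last N)"
    by (simp_all add: L_def nn_concat_def split: prod.split)
  obtain A0 b0 where L0: "last N = (A0, b0)" by (cases "last N")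
  have RL: "rows_le (2 * K) (fst (last L))"
    using rows_le_mult[OF rows_le_cheb_A1 N(2), of m] is_nn_last[OF N(1) L0] cheb_A1_carrier[OF h(1)]
    unfolding Lb(2) by (simp add: L0)
  note size = nn_size_affine_concat_le[OF L RL P S K cheb_A2_carrier rows_le_cheb_A2 cheb_b2_carrier,
      folded N']
  have "N \<noteq> []" using is_nn_nonempty[OF N(1)] .
  then have "nn_size (butlast L) \<le> nn_size N"
    unfolding Lb(1) by (metis append_butlast_last_id le_add1 nn_size_append)
  with size(1) show "nn_size N' \<le> nn_size N + (2 * K\<^sup>2 + 3 * K + 1) * m"
    by (simp add: algebra_simps power2_eq_square)
  show "rows_le (2 * K) (fst (last N'))" by (rule size(2))
qed

section \<open>Induction over the levels with fixed building blocks\<close>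

locale cheb_blocks =
  fixes Cs :: real and Id1 Prd :: "real \<Rightarrow> real \<Rightarrow> nn"
  assumes id_block_Id1: "\<tau> > 0 \<Longrightarrow> B > 0 \<Longrightarrow> id_block Cs \<tau> B (Id1 \<tau> B)"
    and prod_block_Prd: "\<tau> > 0 \<Longrightarrow> B > 0 \<Longrightarrow> prod_block Cs \<tau> B (Prd \<tau> B)"
begin

text \<open>A common integer bound for the size of every block, independent of \<tau> and
  \<open>B\<close>: identities have size at most \<open>2 * Cs\<close>, products at most
  \<open>Cs\<close>.\<close>

definition weight_bound :: nat where "weight_bound = nat \<lfloor>2 * Cs\<rfloor>"

lemma Id1_nn:
  assumes "\<tau> > 0" and "B > 0"
  shows "is_nn 1 1 (Id1 \<tau> B)" "length (Id1 \<tau> B) = 2" "nn_size (Id1 \<tau> B) \<le> weight_bound"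
  using id_block_Id1[OF assms] by (auto simp: id_block_def depth_def weight_bound_def le_nat_floor)

lemma Prd_nn:
  assumes "\<tau> > 0" and "B > 0"
  shows "is_nn 2 1 (Prd \<tau> B)" "length (Prd \<tau> B) = 2" "nn_size (Prd \<tau> B) \<le> weight_bound"
proof -
  have *: "real (nn_size (Prd \<tau> B)) \<le> Cs" using prod_block_Prd[OF assms] by (auto simp: prod_block_def)
  \<comment> \<open>Passing from \<open>Cs\<close> to \<open>2 * Cs\<close> is sound because
    \<open>Cs\<close> dominates a nonnegative size.\<close>
  then have "real (nn_size (Prd \<tau> B)) \<le> 2 * Cs" by linarith
  then show "is_nn 2 1 (Prd \<tau> B)" "length (Prd \<tau> B) = 2" "nn_size (Prd \<tau> B) \<le> weight_bound"
    using prod_block_Prd[OF assms] by (auto simp: prod_block_def depth_def weight_bound_def le_nat_floor)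
qed

text \<open>The input is tripled to (x, x, x), one copy for the identity and two for the product.
  The factor 4 is \<open>m + 2 * 2 ^ k\<close> at m = 2 and k = 0, matching the general size
  bound.\<close>

lemma cheb_nn_2_props:
  fixes \<delta> :: real
  assumes \<delta>: "0 < \<delta>"
  defines "N \<equiv> cheb_nn Id1 Prd 2 \<delta>"
  shows "is_nn 1 2 N" and "length N = 2"
    and "realization \<rho> N (vec_of_list [x]) $ 0 = realization \<rho> (Id1 \<delta> 1) (vec_of_list [x]) $ 0"
    and "realization \<rho> N (vec_of_list [x]) $ 1 =
      2 * realization \<rho> (Prd (\<delta> / 4) 1) (vec_of_list [x, x]) $ 0 - 1"
    and "nn_size N \<le> (2 * weight_bound\<^sup>2 + 3 * weight_bound + 1) * 4"
    and "rows_le (2 * weight_bound) (fst (last N))"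
proof -
  define A :: "real mat" where "A = mat_of_rows_list 2 [[1, 0], [0, 2]]"
  define b :: "real vec" where "b = vec_of_list [0, -1]"
  define M :: "real mat" where "M = mat_of_rows_list 1 [[1], [1], [1]]"
  define I where "I = Id1 \<delta> 1"
  define Q where "Q = Prd (\<delta> / 4) 1"
  have I: "is_nn 1 1 I" "length I = 2" "nn_size I \<le> weight_bound" unfolding I_def using Id1_nn \<delta> by auto
  have Q: "is_nn 2 1 Q" "length Q = 2" "nn_size Q \<le> weight_bound" unfolding Q_def using Prd_nn \<delta> by auto
  have N: "N = [(A, b)] \<bullet>\<^sub>N FP2 I Q \<bullet>\<^sub>N [(M, 0\<^sub>v 3)]"
    by (simp add: N_def cheb_nn_2 A_def b_def M_def I_def Q_def)
  have Ac: "A \<in> carrier_mat 2 2" and bc: "b \<in> carrier_vec 2" and Mc: "M \<in> carrier_mat 3 1"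
    unfolding A_def b_def M_def by (intro carrier_matI carrier_vecI; simp add: mat_of_rows_list_def)+
  have A: "is_nn 2 2 [(A, b)]" and M: "is_nn 1 3 [(M, 0\<^sub>v 3)]" using Ac bc Mc by simp_all
  have len: "length I = length Q" using I Q by simp
  have P: "is_nn 3 2 (FP2 I Q)" "length (FP2 I Q) = 2"
    using is_nn_FP2[OF len I(1) Q(1)] I Q by (simp_all add: length_FP2 numeral_3_eq_3 numeral_2_eq_2)
  have PM: "is_nn 1 2 (FP2 I Q \<bullet>\<^sub>N [(M, 0\<^sub>v 3)])" by (rule is_nn_concat[OF M P(1)])
  show "is_nn 1 2 N" unfolding N by (rule is_nn_concat[OF PM A])
  have "FP2 I Q \<noteq> []" using P(2) by auto
  then show "length N = 2"
    using length_nn_concat[of "FP2 I Q" "[(M, 0\<^sub>v 3)]"]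
      length_nn_concat[of "[(A, b)]" "FP2 I Q \<bullet>\<^sub>N [(M, 0\<^sub>v 3)]"] P(2)
    by (simp add: N nn_concat_nonempty)
  have x: "vec_of_list [x] \<in> carrier_vec 1" and xx: "vec_of_list [x, x] \<in> carrier_vec 2"
    by (intro carrier_vecI; simp)+
  have Mx: "M *\<^sub>v vec_of_list [x] + 0\<^sub>v 3 = vec_of_list [x] @\<^sub>v vec_of_list [x, x]"
    by (intro eq_vecI) (auto simp: M_def mat_of_rows_list_def scalar_prod_def less_Suc_eq numeral_3_eq_3
        vec_of_list_index)
  define y where "y = realization \<rho> I (vec_of_list [x])"
  define z where "z = realization \<rho> Q (vec_of_list [x, x])"
  have y: "y \<in> carrier_vec 1" unfolding y_def by (rule realization_dim[OF I(1) x])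
  have z: "z \<in> carrier_vec 1" unfolding z_def by (rule realization_dim[OF Q(1) xx])
  have "realization \<rho> N (vec_of_list [x]) = A *\<^sub>v (y @\<^sub>v z) + b"
    unfolding N realization_concat[OF PM A x] realization_concat[OF M P(1) x]
    by (simp only: realization.simps Mx realization_FP2[OF len I(1) Q(1) x xx] y_def z_def)
  then show "realization \<rho> N (vec_of_list [x]) $ 0 = realization \<rho> (Id1 \<delta> 1) (vec_of_list [x]) $ 0"
    "realization \<rho> N (vec_of_list [x]) $ 1 =
      2 * realization \<rho> (Prd (\<delta> / 4) 1) (vec_of_list [x, x]) $ 0 - 1"
    unfolding I_def[symmetric] Q_def[symmetric] y_def[symmetric] z_def[symmetric]
    using y z by (auto simp: A_def b_def mat_of_rows_list_def scalar_prod_def numeral_2_eq_2)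
  have "rows_le 1 M" unfolding rows_le_def using Mc by (metis carrier_matD(2) row_nnz_le_dim_col)
  then have RM: "rows_le 1 (fst (last [(M, 0\<^sub>v 3)]))" by simp
  have "nn_size (FP2 I Q) \<le> nn_size I + nn_size Q" by (rule nn_size_FP2_le[OF len])
  then have S: "nn_size (FP2 I Q) \<le> 2 * weight_bound" using I Q by simp
  have ne: "I \<noteq> []" "Q \<noteq> []" using I Q by auto
  have R: "rows_le weight_bound (fst (last (FP2 I Q)))"
    using len ne I Q by (intro rows_le_last_FP2 rows_le_last) auto
  have RA: "rows_le 2 A" unfolding rows_le_def using Ac by (metis carrier_matD(2) row_nnz_le_dim_col)
  note size = nn_size_affine_concat_le[OF M RM P S R Ac RA bc, folded N]
  show "nn_size N \<le> (2 * weight_bound\<^sup>2 + 3 * weight_bound + 1) * 4" using size(1) by (simp add: nn_size_Nil)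
  show "rows_le (2 * weight_bound) (fst (last N))" by (rule size(2))
qed

text \<open>On the diagonal the derivative of the doubled product block is 2 (p1 + p2), with error 2
  (\<delta>/4 + \<delta>/4) = \<delta>; this explains the tolerance \<delta>/4. The range B = 1
  suffices since the arguments are x itself.\<close>

lemma cheb_approx_2:
  assumes \<delta>: "0 < \<delta>" and j: "j \<in> {1..2}"
  shows "cheb_approx \<delta> j (\<lambda>x. realization tanh (cheb_nn Id1 Prd 2 \<delta>) (vec_of_list [x]) $ (j - 1))"
proof (cases "j = 1")
  case True
  have one: "(0::real) < 1" by simp
  let ?I = "\<lambda>x. realization tanh (Id1 \<delta> 1) (vec_of_list [x]) $ 0"
  obtain f' where "\<And>x. (?I has_real_derivative f' x) (at x)" "continuous_on UNIV f'"
    and "\<And>x. \<bar>x\<bar> < 1 \<Longrightarrow> \<bar>x - ?I x\<bar> \<le> \<delta> \<and> \<bar>1 - f' x\<bar> \<le> \<delta>"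
    by (rule id_block_smoothE[OF id_block_Id1[OF \<delta> one]]) (rule that)
  then have "cheb_approx \<delta> 1 ?I"
    unfolding cheb_approx_def by (intro exI[of _ f']) (simp add: pderiv_pCons del: vec_of_list_Cons)
  with True show ?thesis by (simp only: cheb_nn_2_props(3)[OF \<delta>] diff_self_eq_0)
next
  case False
  with j have j: "j = 2" by auto
  let ?P = "\<lambda>x y. realization tanh (Prd (\<delta> / 4) 1) (vec_of_list [x, y]) $ 0"
  have \<delta>4: "0 < \<delta> / 4" and one: "(0::real) < 1" using \<delta> by simp_all
  obtain p1 p2 where
    p: "\<And>u v u' v' t. (u has_real_derivative u') (at t) \<Longrightarrow> (v has_real_derivative v') (at t) \<Longrightarrow>
       ((\<lambda>s. ?P (u s) (v s)) has_real_derivative p1 (u t, v t) * u' + p2 (u t, v t) * v') (at t)"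
    and cp: "continuous_on UNIV p1" "continuous_on UNIV p2"
    and bp: "\<And>x y. \<bar>x\<bar> < 1 \<Longrightarrow> \<bar>y\<bar> < 1 \<Longrightarrow> \<bar>x * y - ?P x y\<bar> \<le> \<delta> / 4 \<and>
       \<bar>y - p1 (x, y)\<bar> \<le> \<delta> / 4 \<and> \<bar>x - p2 (x, y)\<bar> \<le> \<delta> / 4"
    by (rule prod_block_smoothE[OF prod_block_Prd[OF \<delta>4 one]]) (rule that)
  have T: "poly (cheb 2) x = 2 * (x * x) - 1" "poly (pderiv (cheb 2)) x = 2 * (x + x)" for x :: real
    by (simp_all add: numeral_2_eq_2 pderiv_diff pderiv_mult pderiv_pCons)
  let ?f' = "\<lambda>x. 2 * (p1 (x, x) + p2 (x, x))"
  have "cheb_approx \<delta> 2 (\<lambda>x. 2 * ?P x x - 1)"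
    unfolding cheb_approx_def
  proof (intro exI[of _ ?f'] conjI allI impI)
    fix x
    have "((\<lambda>x. ?P x x) has_real_derivative p1 (x, x) * 1 + p2 (x, x) * 1) (at x)"
      by (intro p DERIV_ident)
    then have "((\<lambda>x. 2 * ?P x x - 1) has_real_derivative 2 * (p1 (x, x) * 1 + p2 (x, x) * 1) - 0) (at x)"
      by (intro DERIV_diff DERIV_cmult DERIV_const)
    then show "((\<lambda>x. 2 * ?P x x - 1) has_real_derivative ?f' x) (at x)" by (simp only: mult_1_right diff_zero)
  next
    have "continuous_on UNIV (\<lambda>x. p1 (x, x))" "continuous_on UNIV (\<lambda>x. p2 (x, x))"
      by (rule continuous_on_compose2[OF cp(1)] continuous_on_compose2[OF cp(2)],
          intro continuous_on_Pair continuous_on_id, simp)+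
    then show "continuous_on UNIV ?f'"
      by (intro continuous_on_add continuous_on_mult continuous_on_const)
  next
    fix x :: real assume x: "\<bar>x\<bar> < 1"
    note b = bp[OF x x]
    show "\<bar>poly (cheb 2) x - (2 * ?P x x - 1)\<bar> \<le> \<delta>" unfolding T
      using b \<delta> unfolding abs_le_iff by linarith
    show "\<bar>poly (pderiv (cheb 2)) x - ?f' x\<bar> \<le> \<delta>" unfolding T
      using abs_twice_add_diff_le[of x "p1 (x, x)" "\<delta> / 4" x "p2 (x, x)" "\<delta> / 4" 0 0 0] b by simp
  qed
  moreover have "j - 1 = 1" using j by simp
  ultimately show ?thesis unfolding j by (simp only: cheb_nn_2_props(4)[OF \<delta>] diff_Suc_1 \<open>j - 1 = 1\<close>[unfolded j])
qed

text \<open>The tolerance is read as \<delta> = 4 m^2 \<theta>, so it remains to bound the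
  coefficient of \<theta> in each error by 4 m^2.\<close>

lemma cheb_approx_step:
  assumes \<theta>: "\<theta> = \<delta> / (4 * (real m)\<^sup>2)" and \<delta>: "0 < \<delta>" "\<delta> < 1" and m: "2 < m"
    and h: "mtilde m = 2 * h" "even h" "0 < h" "h < m" "m \<le> 2 * h"
    and N: "is_nn 1 h (cheb_nn Id1 Prd h \<theta>)"
    and approx: "\<And>j. j \<in> {1..h} \<Longrightarrow>
      cheb_approx \<theta> j (\<lambda>x. realization tanh (cheb_nn Id1 Prd h \<theta>) (vec_of_list [x]) $ (j - 1))"
    and j: "j \<in> {1..m}"
  shows "cheb_approx \<delta> j (\<lambda>x. realization tanh (cheb_nn Id1 Prd m \<delta>) (vec_of_list [x]) $ (j - 1))"
proof -
  have m3: "3 \<le> real m" "3 * 3 \<le> (real m)\<^sup>2"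
    using m power_mono[of 3 "real m" 2] by (auto simp: power2_eq_square)
  have \<theta>0: "0 < \<theta>" using \<delta> m by (simp add: \<theta>)
  have \<delta>_eq: "\<delta> = 4 * (real m)\<^sup>2 * \<theta>" using m by (simp add: \<theta>)
  have "1 * \<theta> \<le> 4 * (real m)\<^sup>2 * \<theta>" using m3 \<theta>0 by (intro mult_right_mono) auto
  with \<delta> have \<theta>1: "\<theta> < 1" unfolding \<delta>_eq by linarith
  define I where "I = Id1 \<theta> 2"
  define Q where "Q = Prd \<theta> 2"
  define T where "T x = realization tanh (cheb_nn Id1 Prd h \<theta>) (vec_of_list [x])" for x
  have I: "is_nn 1 1 I" "length I = 2" "id_block Cs \<theta> 2 I"
    unfolding I_def using Id1_nn id_block_Id1 \<theta>0 by auto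
  have Q: "is_nn 2 1 Q" "length Q = 2" "prod_block Cs \<theta> 2 Q"
    unfolding Q_def using Prd_nn prod_block_Prd \<theta>0 by auto
  note N' = cheb_nn_step[OF m h(1) \<theta>, of Id1 Prd, folded I_def Q_def]
  have x: "vec_of_list [x] \<in> carrier_vec 1" for x :: real by (intro carrier_vecI) simp
  have id: "cheb_approx (((real k)\<^sup>2 + 2) * \<theta>) k (\<lambda>x. realization tanh I (vec_of_list [T x $ (k - 1)]) $ 0)"
    if "k \<in> {1..h}" for k
    using cheb_approx_id[OF I(3) _ \<theta>0 \<theta>1] approx[OF that] unfolding T_def .
  show ?thesis
  proof (cases "j \<le> h")
    case True
    with j have jh: "j \<in> {1..h}" "j - 1 < h" by auto
    have "(real j)\<^sup>2 \<le> (real m)\<^sup>2" using j by (intro power_mono) auto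
    with m3 have "(real j)\<^sup>2 + 2 \<le> 4 * (real m)\<^sup>2" by linarith
    then have "((real j)\<^sup>2 + 2) * \<theta> \<le> \<delta>"
      unfolding \<delta>_eq using \<theta>0 by (intro mult_right_mono) auto
    from cheb_approx_mono[OF id[OF jh(1)] this] show ?thesis
      unfolding N' realization_cheb_step_id[OF I(1,2) Q(1,2) N h x jh(2)] T_def .
  next
    case False
    define a b where "a = j div 2" and "b = (j + 1) div 2"
    have ab: "a \<le> b" "a + b = j" "a \<in> {1..h}" "b \<in> {1..h}"
      using False j h by (auto simp: a_def b_def elim!: evenE)
    have j1: "h \<le> j - 1" "j - 1 < m" "j - 1 + 1 = j" "j - 1 + 2 = j + 1" using False j by auto
    let ?h = "\<lambda>x. if even j then 1 else realization tanh I (vec_of_list [T x $ 0]) $ 0"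
    \<comment> \<open>Even degrees subtract the constant 1 without error. Odd degrees subtract the
      identity block applied to T_1, with error (1^2 + 2) \<theta>.\<close>
    have "cheb_approx (3 * \<theta>) (b - a) ?h"
    proof (cases "even j")
      case True
      then have "b - a = 0" by (auto simp: a_def b_def elim!: evenE)
      with True \<theta>0 show ?thesis using cheb_approx_one[of "3 * \<theta>"] by simp
    next
      case False
      then have "b - a = 1" by (auto simp: a_def b_def elim!: oddE)
      with False show ?thesis using id[of 1] h(3) by simp
    qed
    then have "cheb_approx (2 * (2 * ((real a)\<^sup>2 + (real b)\<^sup>2 + 3) * \<theta>) + 3 * \<theta>) (a + b)
        (\<lambda>x. 2 * realization tanh Q (vec_of_list [T x $ (a - 1), T x $ (b - 1)]) $ 0 - ?h x)"
      using approx[OF ab(3)] approx[OF ab(4)] unfolding T_def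
      by (intro cheb_approx_prod[OF Q(3) \<theta>0 \<theta>1 ab(1)])
    moreover have "2 * (2 * ((real a)\<^sup>2 + (real b)\<^sup>2 + 3) * \<theta>) + 3 * \<theta> \<le> \<delta>"
    proof -
      \<comment> \<open>From 2 (a^2 + b^2) = (a + b)^2 + (b - a)^2 with a + b = j and b - a \<le> 1.
        The 15 below is 12 from the product and 3 from the subtracted term.\<close>
      have "4 * ((real a)\<^sup>2 + (real b)\<^sup>2) \<le> 2 * (real j)\<^sup>2 + 2"
        by (cases "even j") (auto simp: a_def b_def power2_eq_square algebra_simps elim!: evenE oddE)
      moreover have "(real j)\<^sup>2 \<le> (real m)\<^sup>2" using j by (intro power_mono) auto
      ultimately have "4 * ((real a)\<^sup>2 + (real b)\<^sup>2) + 15 \<le> 4 * (real m)\<^sup>2" using m3 by linarith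
      then have "(4 * ((real a)\<^sup>2 + (real b)\<^sup>2) + 15) * \<theta> \<le> \<delta>"
        unfolding \<delta>_eq using \<theta>0 by (intro mult_right_mono) auto
      then show ?thesis by (simp add: algebra_simps)
    qed
    ultimately have "cheb_approx \<delta> j
        (\<lambda>x. 2 * realization tanh Q (vec_of_list [T x $ (a - 1), T x $ (b - 1)]) $ 0 - ?h x)"
      unfolding ab(2) by (rule cheb_approx_mono)
    then show ?thesis
      unfolding N' realization_cheb_step_prod[OF I(1,2) Q(1,2) N h x j1(1,2)] j1(3,4)
      unfolding T_def a_def b_def .
  qed
qed

text \<open>In the size bound, \<open>m\<close> accounts for the top level and
  \<open>2 * 2 ^ k\<close> for the geometric sum of the levels below. Both \<open>m\<close> and
  \<delta> vary in the induction, as each level uses a smaller tolerance.\<close>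

lemma cheb_nn_props:
  assumes "2 ^ k < m" and "m \<le> 2 ^ Suc k" and "0 < \<delta>" and "\<delta> < 1"
  defines "N \<equiv> cheb_nn Id1 Prd m \<delta>"
  shows "is_nn 1 m N \<and> length N = k + 2 \<and>
    (\<forall>j\<in>{1..m}. cheb_approx \<delta> j (\<lambda>x. realization tanh N (vec_of_list [x]) $ (j - 1))) \<and>
    nn_size N \<le> (2 * weight_bound\<^sup>2 + 3 * weight_bound + 1) * (m + 2 * 2 ^ k) \<and> rows_le (2 * weight_bound) (fst (last N))"
  using assms(1-4) unfolding N_def
proof (induction k arbitrary: m \<delta>)
  case 0
  then have "m = 2" by simp
  with 0 cheb_nn_2_props[OF \<open>0 < \<delta>\<close>] cheb_approx_2[OF \<open>0 < \<delta>\<close>] show ?case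
    by (simp del: vec_of_list_Cons)
next
  case (Suc k)
  define h :: nat where "h = 2 ^ Suc k"
  define \<theta> where "\<theta> = \<delta> / (4 * (real m)\<^sup>2)"
  have h: "mtilde m = 2 * h" "even h" "0 < h" "h < m" "m \<le> 2 * h"
    using mtilde_eq[OF Suc.prems(1,2)] Suc.prems(1,2) by (auto simp: h_def)
  have "2 \<le> h" by (simp add: h_def)
  with h have m: "2 < m" by linarith
  have \<theta>0: "0 < \<theta>" using Suc.prems m by (simp add: \<theta>_def)
  have "1 * 1 \<le> real m * real m" using m by (intro mult_mono) auto
  then have "\<theta> \<le> \<delta> / 1"
    unfolding \<theta>_def using Suc.prems by (intro divide_left_mono) (auto simp: power2_eq_square)
  with Suc.prems have \<theta>1: "\<theta> < 1" by simp
  \<comment> \<open>The previous network sits at the upper end of its dyadic interval, where the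
    size bound reads 2^(k+1) + 2 * 2^k = 2 * 2^(k+1); adding \<open>m\<close> gives the new bound
    exactly.\<close>
  have "(2::nat) ^ k < h" "h \<le> 2 ^ Suc k" by (simp_all add: h_def)
  note IH = Suc.IH[OF this \<theta>0 \<theta>1]
  then have N: "is_nn 1 h (cheb_nn Id1 Prd h \<theta>)" by simp
  note I = Id1_nn[OF \<theta>0, of 2] and Q = Prd_nn[OF \<theta>0, of 2]
  note eq = cheb_nn_step[OF m h(1) \<theta>_def, of Id1 Prd]
  have "nn_size (cheb_nn Id1 Prd m \<delta>) \<le>
      nn_size (cheb_nn Id1 Prd h \<theta>) + (2 * weight_bound\<^sup>2 + 3 * weight_bound + 1) * m"
    and R: "rows_le (2 * weight_bound) (fst (last (cheb_nn Id1 Prd m \<delta>)))"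
    unfolding eq using nn_size_cheb_step[OF I Q N _ h(1,3,4)] IH by simp_all
  moreover have "nn_size (cheb_nn Id1 Prd h \<theta>) \<le> (2 * weight_bound\<^sup>2 + 3 * weight_bound + 1) * (2 * 2 ^ Suc k)"
    using IH by (simp add: h_def)
  ultimately have "nn_size (cheb_nn Id1 Prd m \<delta>) \<le> (2 * weight_bound\<^sup>2 + 3 * weight_bound + 1) * (m + 2 * 2 ^ Suc k)"
    unfolding add_mult_distrib2 by linarith
  moreover have "cheb_approx \<delta> j (\<lambda>x. realization tanh (cheb_nn Id1 Prd m \<delta>) (vec_of_list [x]) $ (j - 1))"
    if "j \<in> {1..m}" for j
    using IH Suc.prems(3,4) m h N that by (intro cheb_approx_step[OF \<theta>_def]) blast+
  moreover have "is_nn 1 m (cheb_nn Id1 Prd m \<delta>)"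
    unfolding eq by (rule is_nn_cheb_step[OF I(1,2) Q(1,2) N h]) simp_all
  moreover have "length (cheb_nn Id1 Prd m \<delta>) = length (cheb_nn Id1 Prd h \<theta>) + 1"
    unfolding eq by (rule length_cheb_step[OF I(1,2) Q(1,2) N h]) simp_all
  ultimately show ?case using IH R by simp
qed

end

theorem propositionA2:
  fixes Cs :: real
    and Id1 Prd :: "real \<Rightarrow> real \<Rightarrow> nn"
  assumes "Cs > 0"
    and "\<And>\<tau> B. \<tau> > 0 \<Longrightarrow> B > 0 \<Longrightarrow> id_block Cs \<tau> B (Id1 \<tau> B)"
    and "\<And>\<tau> B. \<tau> > 0 \<Longrightarrow> B > 0 \<Longrightarrow> prod_block Cs \<tau> B (Prd \<tau> B)"
  shows "\<exists>C::real. \<forall>m\<ge>2. \<forall>\<delta>::real. 0 < \<delta> \<and> \<delta> < 1 \<longrightarrow>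
    is_nn 1 m (cheb_nn Id1 Prd m \<delta>) \<and>
    (\<forall>k\<in>{1..m}.
       w1inf_norm {-1<..<1}
         (\<lambda>x. poly (cheb k) x - realization tanh (cheb_nn Id1 Prd m \<delta>) (vec_of_list [x]) $ (k - 1))
       \<le> ereal \<delta>) \<and>
    int (depth (cheb_nn Id1 Prd m \<delta>)) = \<lceil>log 2 (real m)\<rceil> + 1 \<and>
    real (nn_size (cheb_nn Id1 Prd m \<delta>)) \<le> C * real m"
proof -
  interpret cheb_blocks Cs Id1 Prd using assms by unfold_locales
  define c where "c = 2 * weight_bound\<^sup>2 + 3 * weight_bound + 1"
  show ?thesis
  \<comment> \<open>The constant depends on \<open>Cs\<close> alone, through
    \<open>weight_bound\<close>. The factor 3 comes from m + 2 * 2^k \<le> 3 m.\<close>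
  proof (intro exI[of _ "3 * real c"] allI impI, elim conjE)
    fix m :: nat and \<delta> :: real assume m: "2 \<le> m" and \<delta>: "0 < \<delta>" "\<delta> < 1"
    define N where "N = cheb_nn Id1 Prd m \<delta>"
    obtain k where k: "2 ^ k < m" "m \<le> 2 ^ Suc k"
      using ex_power_ivl2[of 2 m] m by auto
    note props = cheb_nn_props[OF k \<delta>, folded N_def c_def]
    have "\<lceil>log 2 (real m)\<rceil> = int k + 1"
      using ceiling_log_nat_eq_if[of 2 k m] k by simp
    then have "int (depth N) = \<lceil>log 2 (real m)\<rceil> + 1" using props by (simp add: depth_def)
    moreover have "real (nn_size N) \<le> 3 * real c * real m"
    proof -
      have "nn_size N \<le> c * (m + 2 * 2 ^ k)" using props by blast
      also have "\<dots> \<le> c * (3 * m)" using k(1) by (intro mult_left_mono) auto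
      finally have "nn_size N \<le> 3 * c * m" by (simp add: mult_ac)
      then show ?thesis using of_nat_mono[of _ "3 * c * m", where ?'a = real] by simp
    qed
    ultimately show "is_nn 1 m N \<and> (\<forall>k\<in>{1..m}. w1inf_norm {-1<..<1}
         (\<lambda>x. poly (cheb k) x - realization tanh N (vec_of_list [x]) $ (k - 1)) \<le> ereal \<delta>) \<and>
       int (depth N) = \<lceil>log 2 (real m)\<rceil> + 1 \<and> real (nn_size N) \<le> 3 * real c * real m"
      using props w1inf_norm_cheb_approx by blast
  qed
qed

end
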